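(* The operad $\operatorname{PreLie}$ has a unique structure of anticyclic operad such that the inclusion map $\operatorname{PreLie}\to\operatorname{Dend}$ is a morphism of anticyclic operads.
   Context: All vector spaces are over $\mathbb{Q}$. The symmetric group $\mathfrak{S}_n$ acts on $\mathcal{P}(n)$ by $(\sigma\cdot E)(x_1,\dots,x_n)=E(x_{\sigma(1)},\dots,x_{\sigma(n)})$. An anticyclic operad is a symmetric operad $\mathcal{P}$ (unit $1\in\mathcal{P}(1)$, partial compositions $\circ_i$) together with an action of $\mathfrak{S}_{n+1}$ on each $\mathcal{P}(n)$ extending the action of $\mathfrak{S}_n$ (the stabilizer of $n+1$), such that, writing $\tau_n$ for the action of the long cycle $(n+1,n,\dots,2,1)$ ($1\mapsto n+1$, $i\mapsto i-1$ for $i\ge 2$): $\tau_1(1)=-1$ and, for $f\in\mathcal{P}(m)$, $g\in\mathcal{P}(n)$, $\tau(f\circ_i g)=\tau_m(f)\circ_{i-1}g$ for $2\le i\le m$ and $\tau(f\circ_1 g)=-\tau_n(g)\circ_n\tau_m(f)$. A morphism of anticyclic operads is a morphism of operads commuting with the actions of $\mathfrak{S}_{n+1}$. A non-symmetric anticyclic operad is a non-symmetric operad with endomorphisms $\tau_n$ of $\mathcal{P}(n)$ satisfying $\tau_n^{n+1}=\mathrm{Id}$ and these same identities. If $\mathcal{P}$ is a non-symmetric anticyclic operad, the symmetric operad with components $\mathcal{P}(n)\otimes\mathbb{Q}\mathfrak{S}_n\cong\operatorname{Ind}_{\mathbb{Z}/(n+1)\mathbb{Z}}^{\mathfrak{S}_{n+1}}\mathcal{P}(n)$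 is naturally an anticyclic operad, with $\tau_n(E\otimes 1)=\tau_n(E)\otimes 1$. The non-symmetric operad $\operatorname{Dend}$ is generated by binary operations $x\prec y$, $x\succ y$ with relations $(x\prec y)\prec z=x\prec(y\prec z)+x\prec(y\succ z)$, $x\succ(y\prec z)=(x\succ y)\prec z$, $x\succ(y\succ z)=(x\succ y)\succ z+(x\prec y)\succ z$. It is a non-symmetric anticyclic operad with the unique structure such that $\tau_1=-\mathrm{Id}$, $\tau_2(x_1\succ x_2)=x_1\prec x_2$, $\tau_2(x_1\prec x_2)=-x_1\prec x_2-x_1\succ x_2$. In the claim, $\operatorname{Dend}$ denotes the associated (symmetric) anticyclic operad. $\operatorname{PreLie}$ is the sub-operad of the symmetric operad $\operatorname{Dend}$ generated by $x_1\curvearrowleft x_2=x_2\succ x_1-x_1\prec x_2$; it is presented by the binary product $x\curvearrowleft y$ (no symmetry) with relation $(x\curvearrowleft y)\curvearrowleft z-x\curvearrowleft(y\curvearrowleft z)=(x\curvearrowleft z)\curvearrowleft y-x\curvearrowleft(z\curvearrowleft y)$. *)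

theory Defs
  imports
    Complex_Main
    "HOL-Library.Poly_Mapping"
    "HOL-Library.Function_Algebras"
    "HOL-Combinatorics.Permutations"
begin

section \<open>Vector spaces over the rationals\<close>

class rat_vector = ab_group_add +
  fixes scaleQ :: "rat \<Rightarrow> 'a \<Rightarrow> 'a"  (infixr \<open>*\<^sub>Q\<close> 75)
  assumes scaleQ_add_right: "c *\<^sub>Q (x + y) = c *\<^sub>Q x + c *\<^sub>Q y"
    and scaleQ_add_left: "(c + d) *\<^sub>Q x = c *\<^sub>Q x + d *\<^sub>Q x"
    and scaleQ_scaleQ: "c *\<^sub>Q d *\<^sub>Q x = (c * d) *\<^sub>Q x"
    and scaleQ_one: "1 *\<^sub>Q x = x"

global_interpretation rat_vector: vector_space "scaleQ :: rat \<Rightarrow> 'a \<Rightarrow> 'a::rat_vector"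
  by unfold_locales (simp_all add: scaleQ_add_right scaleQ_add_left scaleQ_scaleQ scaleQ_one)

definition linear_on_Q :: "'a::rat_vector set \<Rightarrow> ('a \<Rightarrow> 'b::rat_vector) \<Rightarrow> bool" where
  "linear_on_Q V f \<longleftrightarrow>
     (\<forall>x\<in>V. \<forall>y\<in>V. f (x + y) = f x + f y) \<and> (\<forall>c. \<forall>x\<in>V. f (c *\<^sub>Q x) = c *\<^sub>Q f x)"

instantiation rat :: rat_vector
begin
definition scaleQ_rat :: "rat \<Rightarrow> rat \<Rightarrow> rat" where "scaleQ_rat = (*)"
instance by standard (simp_all add: scaleQ_rat_def algebra_simps)
end

instantiation "fun" :: (type, rat_vector) rat_vector
begin
definition scaleQ_fun :: "rat \<Rightarrow> ('a \<Rightarrow> 'b) \<Rightarrow> 'a \<Rightarrow> 'b" where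
  "scaleQ_fun c f = (\<lambda>x. c *\<^sub>Q f x)"
instance
  by standard
    (simp_all add: scaleQ_fun_def plus_fun_def fun_eq_iff scaleQ_add_right scaleQ_add_left
      scaleQ_scaleQ scaleQ_one)
end

instantiation poly_mapping :: (type, rat_vector) rat_vector
begin
definition scaleQ_poly_mapping :: "rat \<Rightarrow> ('a \<Rightarrow>\<^sub>0 'b) \<Rightarrow> 'a \<Rightarrow>\<^sub>0 'b" where
  "scaleQ_poly_mapping c = Poly_Mapping.map (scaleQ c)"

lemma lookup_scaleQ [simp]:
  "Poly_Mapping.lookup (c *\<^sub>Q f) k = c *\<^sub>Q Poly_Mapping.lookup (f :: 'a \<Rightarrow>\<^sub>0 'b) k"
  by (simp add: scaleQ_poly_mapping_def Poly_Mapping.map.rep_eq when_def)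

instance
  by standard
    (auto intro!: poly_mapping_eqI simp: lookup_add scaleQ_add_right scaleQ_add_left
      scaleQ_scaleQ scaleQ_one)
end


section \<open>Non-symmetric and symmetric operads\<close>

text \<open>
  An operad consists of vector spaces \<open>P(n)\<close> for \<open>n \<ge> 1\<close>, realised as subspaces of one ambient
  rational vector space; the value of \<open>components\<close> at \<open>0\<close> carries no meaning. The partial
  composition \<open>f \<circ>\<^sub>i g\<close> of \<open>f \<in> P(m)\<close> and \<open>g \<in> P(n)\<close> is written \<open>pcomp P m n i f g\<close>; the
  arities are arguments because the components need not be disjoint inside the ambient space.
\<close>

record 'a ns_operad_data =
  components :: "nat \<Rightarrow> 'a set"
  op_unit :: 'a
  pcomp :: "nat \<Rightarrow> nat \<Rightarrow> nat \<Rightarrow> 'a \<Rightarrow> 'a \<Rightarrow> 'a"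

record 'a operad_data = "'a ns_operad_data" +
  perm_act :: "nat \<Rightarrow> (nat \<Rightarrow> nat) \<Rightarrow> 'a \<Rightarrow> 'a"

locale ns_operad =
  fixes P :: "('a::rat_vector, 'b) ns_operad_data_scheme"
  assumes subspace: "1 \<le> n \<Longrightarrow> rat_vector.subspace (components P n)"
    and unit_closed: "op_unit P \<in> components P 1"
    and pcomp_closed:
      "\<lbrakk>f \<in> components P m; g \<in> components P n; 1 \<le> i; i \<le> m; 1 \<le> n\<rbrakk>
       \<Longrightarrow> pcomp P m n i f g \<in> components P (m + n - 1)"
    and pcomp_linear_left:
      "\<lbrakk>g \<in> components P n; 1 \<le> i; i \<le> m; 1 \<le> n\<rbrakk>
       \<Longrightarrow> linear_on_Q (components P m) (\<lambda>f. pcomp P m n i f g)"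
    and pcomp_linear_right:
      "\<lbrakk>f \<in> components P m; 1 \<le> i; i \<le> m; 1 \<le> n\<rbrakk>
       \<Longrightarrow> linear_on_Q (components P n) (\<lambda>g. pcomp P m n i f g)"
    and unit_left:
      "\<lbrakk>g \<in> components P n; 1 \<le> n\<rbrakk> \<Longrightarrow> pcomp P 1 n 1 (op_unit P) g = g"
    and unit_right:
      "\<lbrakk>f \<in> components P m; 1 \<le> i; i \<le> m\<rbrakk> \<Longrightarrow> pcomp P m 1 i f (op_unit P) = f"
    and assoc_sequential:
      "\<lbrakk>f \<in> components P m; g \<in> components P n; h \<in> components P l;
        1 \<le> i; i \<le> m; 1 \<le> j; j \<le> n; 1 \<le> l\<rbrakk>
       \<Longrightarrow> pcomp P (m + n - 1) l (i - 1 + j) (pcomp P m n i f g) h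
         = pcomp P m (n + l - 1) i f (pcomp P n l j g h)"
    and assoc_parallel:
      "\<lbrakk>f \<in> components P m; g \<in> components P n; h \<in> components P l;
        1 \<le> i; i < k; k \<le> m; 1 \<le> n; 1 \<le> l\<rbrakk>
       \<Longrightarrow> pcomp P (m + n - 1) l (k - 1 + n) (pcomp P m n i f g) h
         = pcomp P (m + l - 1) n i (pcomp P m l k f h) g"

text \<open>
  Permutations act by \<open>(\<sigma> \<cdot> E)(x\<^sub>1, \<dots>, x\<^sub>n) = E(x\<^bsub>\<sigma>(1)\<^esub>, \<dots>, x\<^bsub>\<sigma>(n)\<^esub>)\<close>, a left action. Substituting
  \<open>g(x\<^sub>i, \<dots>, x\<^bsub>i+n-1\<^esub>)\<close> for the \<open>i\<close>-th argument of \<open>\<sigma> \<cdot> f\<close> means substituting it for the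
  argument of \<open>f\<close> in position \<open>k = \<sigma>\<^sup>-\<^sup>1(i)\<close>, whence
  \<open>(\<sigma> \<cdot> f) \<circ>\<^sub>i g = block_perm m n i \<sigma> \<cdot> (f \<circ>\<^sub>k g)\<close> and
  \<open>f \<circ>\<^sub>i (\<rho> \<cdot> g) = shift_perm n i \<rho> \<cdot> (f \<circ>\<^sub>i g)\<close>.
\<close>

definition block_perm :: "nat \<Rightarrow> nat \<Rightarrow> nat \<Rightarrow> (nat \<Rightarrow> nat) \<Rightarrow> nat \<Rightarrow> nat" where
  "block_perm m n i \<sigma> =
     (let k = inv \<sigma> i; e = (\<lambda>j. if j < i then j else j + n - 1) in
      (\<lambda>p. if p \<in> {1..m + n - 1} then
            (if p < k then e (\<sigma> p)
             else if p < k + n then i + (p - k)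
             else e (\<sigma> (p + 1 - n)))
          else p))"

definition shift_perm :: "nat \<Rightarrow> nat \<Rightarrow> (nat \<Rightarrow> nat) \<Rightarrow> nat \<Rightarrow> nat" where
  "shift_perm n i \<rho> = (\<lambda>p. if i \<le> p \<and> p < i + n then \<rho> (p + 1 - i) + i - 1 else p)"

text \<open>Linear actions of \<open>\<SS>\<^bsub>N\<^esub>\<close> on a space \<open>V\<close>.\<close>

definition linear_sym_action ::
    "nat \<Rightarrow> 'a::rat_vector set \<Rightarrow> ((nat \<Rightarrow> nat) \<Rightarrow> 'a \<Rightarrow> 'a) \<Rightarrow> bool" where
  "linear_sym_action N V a \<longleftrightarrow>
     (\<forall>\<sigma>. \<sigma> permutes {1..N} \<longrightarrow> linear_on_Q V (a \<sigma>) \<and> (\<forall>x\<in>V. a \<sigma> x \<in> V)) \<and>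
     (\<forall>x\<in>V. a id x = x) \<and>
     (\<forall>\<sigma> \<rho>. \<sigma> permutes {1..N} \<longrightarrow> \<rho> permutes {1..N} \<longrightarrow>
        (\<forall>x\<in>V. a (\<sigma> \<circ> \<rho>) x = a \<sigma> (a \<rho> x)))"

locale operad = ns_operad P for P :: "('a::rat_vector, 'b) operad_data_scheme" +
  assumes perm_action: "1 \<le> n \<Longrightarrow> linear_sym_action n (components P n) (perm_act P n)"
    and equivariant_left:
      "\<lbrakk>f \<in> components P m; g \<in> components P n; 1 \<le> i; i \<le> m; 1 \<le> n; \<sigma> permutes {1..m}\<rbrakk>
       \<Longrightarrow> pcomp P m n i (perm_act P m \<sigma> f) g
         = perm_act P (m + n - 1) (block_perm m n i \<sigma>) (pcomp P m n (inv \<sigma> i) f g)"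
    and equivariant_right:
      "\<lbrakk>f \<in> components P m; g \<in> components P n; 1 \<le> i; i \<le> m; 1 \<le> n; \<rho> permutes {1..n}\<rbrakk>
       \<Longrightarrow> pcomp P m n i f (perm_act P n \<rho> g)
         = perm_act P (m + n - 1) (shift_perm n i \<rho>) (pcomp P m n i f g)"

locale operad_morphism = source: operad P + target: operad Q
  for P :: "('a::rat_vector, 'b) operad_data_scheme"
    and Q :: "('c::rat_vector, 'd) operad_data_scheme" +
  fixes \<phi> :: "nat \<Rightarrow> 'a \<Rightarrow> 'c"
  assumes map_closed: "\<lbrakk>x \<in> components P n; 1 \<le> n\<rbrakk> \<Longrightarrow> \<phi> n x \<in> components Q n"
    and map_linear: "1 \<le> n \<Longrightarrow> linear_on_Q (components P n) (\<phi> n)"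
    and map_unit: "\<phi> 1 (op_unit P) = op_unit Q"
    and map_pcomp:
      "\<lbrakk>f \<in> components P m; g \<in> components P n; 1 \<le> i; i \<le> m; 1 \<le> n\<rbrakk>
       \<Longrightarrow> \<phi> (m + n - 1) (pcomp P m n i f g) = pcomp Q m n i (\<phi> m f) (\<phi> n g)"
    and map_perm_act:
      "\<lbrakk>x \<in> components P n; 1 \<le> n; \<sigma> permutes {1..n}\<rbrakk>
       \<Longrightarrow> \<phi> n (perm_act P n \<sigma> x) = perm_act Q n \<sigma> (\<phi> n x)"

definition suboperad ::
    "('a::rat_vector, 'b) operad_data_scheme \<Rightarrow> (nat \<Rightarrow> 'a set) \<Rightarrow> bool" where
  "suboperad P S \<longleftrightarrow>
     (\<forall>n\<ge>1. rat_vector.subspace (S n) \<and> S n \<subseteq> components P n) \<and>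
     op_unit P \<in> S 1 \<and>
     (\<forall>m n i. 1 \<le> i \<longrightarrow> i \<le> m \<longrightarrow> 1 \<le> n \<longrightarrow>
        (\<forall>f\<in>S m. \<forall>g\<in>S n. pcomp P m n i f g \<in> S (m + n - 1))) \<and>
     (\<forall>n\<ge>1. \<forall>\<sigma>. \<sigma> permutes {1..n} \<longrightarrow> (\<forall>x\<in>S n. perm_act P n \<sigma> x \<in> S n))"

definition generated_suboperad ::
    "'a::rat_vector operad_data \<Rightarrow> (nat \<Rightarrow> 'a set) \<Rightarrow> 'a operad_data" where
  "generated_suboperad P X =
     P\<lparr>components := (\<lambda>n. \<Inter>{S n | S. suboperad P S \<and> (\<forall>k\<ge>1. X k \<subseteq> S k)})\<rparr>"


section \<open>Anticyclic operads\<close>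

text \<open>The cycle \<open>(n+1, n, \<dots>, 2, 1)\<close>.\<close>

definition long_cycle :: "nat \<Rightarrow> nat \<Rightarrow> nat" where
  "long_cycle n = (\<lambda>i. if i = 1 then n + 1 else if 2 \<le> i \<and> i \<le> n + 1 then i - 1 else i)"

locale ns_anticyclic_operad = ns_operad P
  for P :: "('a::rat_vector, 'b) ns_operad_data_scheme" +
  fixes \<tau> :: "nat \<Rightarrow> 'a \<Rightarrow> 'a"
  assumes tau_closed: "\<lbrakk>f \<in> components P n; 1 \<le> n\<rbrakk> \<Longrightarrow> \<tau> n f \<in> components P n"
    and tau_linear: "1 \<le> n \<Longrightarrow> linear_on_Q (components P n) (\<tau> n)"
    and tau_order: "\<lbrakk>f \<in> components P n; 1 \<le> n\<rbrakk> \<Longrightarrow> (\<tau> n ^^ (n + 1)) f = f"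
    and tau_unit: "\<tau> 1 (op_unit P) = - op_unit P"
    and tau_pcomp:
      "\<lbrakk>f \<in> components P m; g \<in> components P n; 2 \<le> i; i \<le> m; 1 \<le> n\<rbrakk>
       \<Longrightarrow> \<tau> (m + n - 1) (pcomp P m n i f g) = pcomp P m n (i - 1) (\<tau> m f) g"
    and tau_pcomp_first:
      "\<lbrakk>f \<in> components P m; g \<in> components P n; 1 \<le> m; 1 \<le> n\<rbrakk>
       \<Longrightarrow> \<tau> (m + n - 1) (pcomp P m n 1 f g) = - pcomp P n m n (\<tau> n g) (\<tau> m f)"

text \<open>
  An anticyclic structure on \<open>P\<close> is a family \<open>\<alpha>\<close>, where \<open>\<alpha> n\<close> is an action of \<open>\<SS>\<^bsub>n+1\<^esub>\<close> on \<open>P(n)\<close>.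
  The stabilizer of \<open>n + 1\<close> consists of the permutations of \<open>{1..n}\<close>, regarded as functions
  fixing all other numbers.
\<close>

locale anticyclic_operad = operad P
  for P :: "('a::rat_vector, 'b) operad_data_scheme" +
  fixes \<alpha> :: "nat \<Rightarrow> (nat \<Rightarrow> nat) \<Rightarrow> 'a \<Rightarrow> 'a"
  assumes cyc_action: "1 \<le> n \<Longrightarrow> linear_sym_action (n + 1) (components P n) (\<alpha> n)"
    and cyc_extends:
      "\<lbrakk>f \<in> components P n; 1 \<le> n; \<sigma> permutes {1..n}\<rbrakk> \<Longrightarrow> \<alpha> n \<sigma> f = perm_act P n \<sigma> f"
    and cyc_unit: "\<alpha> 1 (long_cycle 1) (op_unit P) = - op_unit P"
    and cyc_pcomp:
      "\<lbrakk>f \<in> components P m; g \<in> components P n; 2 \<le> i; i \<le> m; 1 \<le> n\<rbrakk>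
       \<Longrightarrow> \<alpha> (m + n - 1) (long_cycle (m + n - 1)) (pcomp P m n i f g)
         = pcomp P m n (i - 1) (\<alpha> m (long_cycle m) f) g"
    and cyc_pcomp_first:
      "\<lbrakk>f \<in> components P m; g \<in> components P n; 1 \<le> m; 1 \<le> n\<rbrakk>
       \<Longrightarrow> \<alpha> (m + n - 1) (long_cycle (m + n - 1)) (pcomp P m n 1 f g)
         = - pcomp P n m n (\<alpha> n (long_cycle n) g) (\<alpha> m (long_cycle m) f)"

locale anticyclic_morphism =
  source: anticyclic_operad P \<alpha> + target: anticyclic_operad Q \<beta> + operad_morphism P Q \<phi>
  for P :: "('a::rat_vector, 'b) operad_data_scheme" and \<alpha>
    and Q :: "('c::rat_vector, 'd) operad_data_scheme" and \<beta>
    and \<phi> :: "nat \<Rightarrow> 'a \<Rightarrow> 'c" +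
  assumes map_cyc:
      "\<lbrakk>x \<in> components P n; 1 \<le> n; \<sigma> permutes {1..n + 1}\<rbrakk>
       \<Longrightarrow> \<phi> n (\<alpha> n \<sigma> x) = \<beta> n \<sigma> (\<phi> n x)"


section \<open>The symmetric operad of a non-symmetric operad\<close>

text \<open>
  \<open>P(n) \<otimes> \<rat>\<SS>\<^sub>n\<close> is the space of functions from permutations to \<open>P(n)\<close> supported on \<open>\<SS>\<^sub>n\<close>, the
  function \<open>x\<close> standing for the sum of the \<open>x(\<sigma>) \<otimes> \<sigma>\<close>. Since \<open>E \<otimes> \<sigma> = \<sigma> \<cdot> (E \<otimes> 1)\<close>,
  equivariance forces
  \<open>(E \<otimes> \<sigma>) \<circ>\<^sub>i (F \<otimes> \<rho>) = (E \<circ>\<^sub>k F) \<otimes> (block_perm m n i \<sigma> \<circ> shift_perm n k \<rho>)\<close>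
  with \<open>k = \<sigma>\<^sup>-\<^sup>1(i)\<close>.
\<close>

definition tens :: "'a::zero \<Rightarrow> (nat \<Rightarrow> nat) \<Rightarrow> (nat \<Rightarrow> nat) \<Rightarrow> 'a" where
  "tens E \<sigma> = (\<lambda>\<pi>. if \<pi> = \<sigma> then E else 0)"

definition symmetrization ::
    "('a::rat_vector) ns_operad_data \<Rightarrow> ((nat \<Rightarrow> nat) \<Rightarrow> 'a) operad_data" where
  "symmetrization P =
    \<lparr>components = (\<lambda>n. {x. \<forall>\<pi>. if \<pi> permutes {1..n} then x \<pi> \<in> components P n else x \<pi> = 0}),
     op_unit = tens (op_unit P) id,
     pcomp = (\<lambda>m n i x y.
       \<Sum>\<sigma> | \<sigma> permutes {1..m}. \<Sum>\<rho> | \<rho> permutes {1..n}.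
         tens (pcomp P m n (inv \<sigma> i) (x \<sigma>) (y \<rho>))
              (block_perm m n i \<sigma> \<circ> shift_perm n (inv \<sigma> i) \<rho>)),
     perm_act = (\<lambda>n \<pi> x. \<Sum>\<sigma> | \<sigma> permutes {1..n}. tens (x \<sigma>) (\<pi> \<circ> \<sigma>))\<rparr>"

text \<open>
  The action of \<open>\<SS>\<^bsub>n+1\<^esub>\<close> on \<open>P(n) \<otimes> \<rat>\<SS>\<^sub>n\<close> as the representation induced from the cyclic group
  generated by \<open>c = long_cycle n\<close>: each \<open>\<pi> \<circ> \<sigma>\<close> is \<open>s \<circ> c\<^sup>k\<close> for exactly one \<open>s \<in> \<SS>\<^sub>n\<close> and one
  \<open>k \<le> n\<close>, and \<open>\<pi> \<cdot> (E \<otimes> \<sigma>) = \<tau>\<^sub>n\<^sup>k(E) \<otimes> s\<close>. In particular \<open>c \<cdot> (E \<otimes> 1) = \<tau>\<^sub>n(E) \<otimes> 1\<close>.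
\<close>

definition induced_action ::
    "(nat \<Rightarrow> 'a::rat_vector \<Rightarrow> 'a) \<Rightarrow> nat \<Rightarrow> (nat \<Rightarrow> nat) \<Rightarrow> ((nat \<Rightarrow> nat) \<Rightarrow> 'a) \<Rightarrow> (nat \<Rightarrow> nat) \<Rightarrow> 'a"
  where
  "induced_action \<tau> n \<pi> x =
     (\<Sum>\<sigma> | \<sigma> permutes {1..n}. \<Sum>s | s permutes {1..n}. \<Sum>k\<in>{0..n}.
        if \<pi> \<circ> \<sigma> = s \<circ> (long_cycle n ^^ k) then tens ((\<tau> n ^^ k) (x \<sigma>)) s else 0)"


section \<open>The dendriform operad\<close>

text \<open>
  The free non-symmetric operad on two binary generators: a tree with \<open>n\<close> leaves is a monomial
  in \<open>x\<^sub>1, \<dots>, x\<^sub>n\<close>, in this order, and composition grafts a tree on the \<open>i\<close>-th leaf.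
\<close>

datatype dtree = Leaf | Prec dtree dtree | Succ dtree dtree

fun leaves :: "dtree \<Rightarrow> nat" where
  "leaves Leaf = 1"
| "leaves (Prec a b) = leaves a + leaves b"
| "leaves (Succ a b) = leaves a + leaves b"

fun graft :: "dtree \<Rightarrow> nat \<Rightarrow> dtree \<Rightarrow> dtree" where
  "graft Leaf i s = s"
| "graft (Prec a b) i s =
    (if i \<le> leaves a then Prec (graft a i s) b else Prec a (graft b (i - leaves a) s))"
| "graft (Succ a b) i s =
    (if i \<le> leaves a then Succ (graft a i s) b else Succ a (graft b (i - leaves a) s))"

abbreviation tree_monom :: "dtree \<Rightarrow> dtree \<Rightarrow>\<^sub>0 rat" where
  "tree_monom t \<equiv> Poly_Mapping.single t 1"

text \<open>
  Linear combinations of trees of different arities are allowed here; a tree with fewer than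
  \<open>i\<close> leaves contributes \<open>0\<close> to the composition at \<open>i\<close>.
\<close>

definition graft_basis :: "nat \<Rightarrow> dtree \<Rightarrow> dtree \<Rightarrow> dtree \<Rightarrow>\<^sub>0 rat" where
  "graft_basis i t s = (if 1 \<le> i \<and> i \<le> leaves t then tree_monom (graft t i s) else 0)"

definition free_comp :: "nat \<Rightarrow> (dtree \<Rightarrow>\<^sub>0 rat) \<Rightarrow> (dtree \<Rightarrow>\<^sub>0 rat) \<Rightarrow> dtree \<Rightarrow>\<^sub>0 rat" where
  "free_comp i x y =
     (\<Sum>t\<in>Poly_Mapping.keys x. \<Sum>s\<in>Poly_Mapping.keys y.
        (Poly_Mapping.lookup x t * Poly_Mapping.lookup y s) *\<^sub>Q graft_basis i t s)"

inductive_set dend_ideal :: "(dtree \<Rightarrow>\<^sub>0 rat) set" where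
  rel_prec: "tree_monom (Prec (Prec Leaf Leaf) Leaf)
     - (tree_monom (Prec Leaf (Prec Leaf Leaf)) + tree_monom (Prec Leaf (Succ Leaf Leaf)))
       \<in> dend_ideal"
| rel_mid: "tree_monom (Succ Leaf (Prec Leaf Leaf))
     - tree_monom (Prec (Succ Leaf Leaf) Leaf) \<in> dend_ideal"
| rel_succ: "tree_monom (Succ Leaf (Succ Leaf Leaf))
     - (tree_monom (Succ (Succ Leaf Leaf) Leaf) + tree_monom (Succ (Prec Leaf Leaf) Leaf))
       \<in> dend_ideal"
| zero: "0 \<in> dend_ideal"
| add: "x \<in> dend_ideal \<Longrightarrow> y \<in> dend_ideal \<Longrightarrow> x + y \<in> dend_ideal"
| scale: "x \<in> dend_ideal \<Longrightarrow> c *\<^sub>Q x \<in> dend_ideal"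
| comp_left: "x \<in> dend_ideal \<Longrightarrow> free_comp i x y \<in> dend_ideal"
| comp_right: "y \<in> dend_ideal \<Longrightarrow> free_comp i x y \<in> dend_ideal"

lemma dend_ideal_diff: "x \<in> dend_ideal \<Longrightarrow> y \<in> dend_ideal \<Longrightarrow> x - y \<in> dend_ideal"
  using dend_ideal.add[of x "(-1) *\<^sub>Q y"] dend_ideal.scale[of y "-1"]
  by simp

lemma dend_ideal_uminus: "x \<in> dend_ideal \<Longrightarrow> - x \<in> dend_ideal"
  using dend_ideal_diff[OF dend_ideal.zero, of x] by simp

lemma free_comp_superset:
  assumes "finite A" "Poly_Mapping.keys x \<subseteq> A" "finite B" "Poly_Mapping.keys y \<subseteq> B"
  shows "free_comp i x y =
     (\<Sum>t\<in>A. \<Sum>s\<in>B. (Poly_Mapping.lookup x t * Poly_Mapping.lookup y s) *\<^sub>Q graft_basis i t s)"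
proof -
  have "free_comp i x y = (\<Sum>t\<in>Poly_Mapping.keys x. \<Sum>s\<in>B.
      (Poly_Mapping.lookup x t * Poly_Mapping.lookup y s) *\<^sub>Q graft_basis i t s)"
    unfolding free_comp_def using assms
    by (intro sum.cong refl sum.mono_neutral_left) (auto simp: in_keys_iff)
  also have "\<dots> = (\<Sum>t\<in>A. \<Sum>s\<in>B.
      (Poly_Mapping.lookup x t * Poly_Mapping.lookup y s) *\<^sub>Q graft_basis i t s)"
    using assms by (intro sum.mono_neutral_left) (auto simp: in_keys_iff)
  finally show ?thesis .
qed

lemma free_comp_diff_left: "free_comp i (x - x') y = free_comp i x y - free_comp i x' y"
proof -
  let ?A = "Poly_Mapping.keys x \<union> Poly_Mapping.keys x'"
  have "Poly_Mapping.keys (x - x') \<subseteq> ?A"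
    by (auto simp: in_keys_iff lookup_minus)
  then show ?thesis
    by (simp add: free_comp_superset[of ?A _ "Poly_Mapping.keys y"] lookup_minus
        left_diff_distrib rat_vector.scale_left_diff_distrib sum_subtractf)
qed

lemma free_comp_diff_right: "free_comp i x (y - y') = free_comp i x y - free_comp i x y'"
proof -
  let ?B = "Poly_Mapping.keys y \<union> Poly_Mapping.keys y'"
  have "Poly_Mapping.keys (y - y') \<subseteq> ?B"
    by (auto simp: in_keys_iff lookup_minus)
  then show ?thesis
    by (simp add: free_comp_superset[of "Poly_Mapping.keys x" _ ?B] lookup_minus
        right_diff_distrib rat_vector.scale_left_diff_distrib sum_subtractf)
qed

definition dend_eq :: "(dtree \<Rightarrow>\<^sub>0 rat) \<Rightarrow> (dtree \<Rightarrow>\<^sub>0 rat) \<Rightarrow> bool" where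
  "dend_eq x y \<longleftrightarrow> x - y \<in> dend_ideal"

lemma equivp_dend_eq: "equivp dend_eq"
proof (rule equivpI)
  show "reflp dend_eq"
    by (simp add: reflp_def dend_eq_def dend_ideal.zero)
  show "symp dend_eq"
    unfolding symp_def dend_eq_def by (metis dend_ideal_uminus minus_diff_eq)
  show "transp dend_eq"
  proof (rule transpI)
    fix x y z
    assume "dend_eq x y" "dend_eq y z"
    then have "(x - y) + (y - z) \<in> dend_ideal"
      unfolding dend_eq_def by (rule dend_ideal.add)
    then show "dend_eq x z"
      by (simp add: dend_eq_def)
  qed
qed

quotient_type dend = "dtree \<Rightarrow>\<^sub>0 rat" / dend_eq
  by (rule equivp_dend_eq)

instantiation dend :: rat_vector
begin

lift_definition zero_dend :: dend is 0 .

lift_definition plus_dend :: "dend \<Rightarrow> dend \<Rightarrow> dend" is "(+)"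
  unfolding dend_eq_def by (metis add_diff_add dend_ideal.add)

lift_definition uminus_dend :: "dend \<Rightarrow> dend" is uminus
  unfolding dend_eq_def by (metis dend_ideal_uminus minus_diff_minus)

lift_definition minus_dend :: "dend \<Rightarrow> dend \<Rightarrow> dend" is "(-)"
proof -
  fix x x' y y'
  assume "dend_eq x x'" "dend_eq y y'"
  then have "(x - x') - (y - y') \<in> dend_ideal"
    by (simp add: dend_eq_def dend_ideal_diff)
  then show "dend_eq (x - y) (x' - y')"
    by (simp add: dend_eq_def algebra_simps)
qed

lift_definition scaleQ_dend :: "rat \<Rightarrow> dend \<Rightarrow> dend" is scaleQ
  unfolding dend_eq_def by (metis dend_ideal.scale rat_vector.scale_right_diff_distrib)

instance
  by standard
    (transfer; simp add: dend_eq_def dend_ideal.zero scaleQ_add_right scaleQ_add_left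
      scaleQ_scaleQ scaleQ_one algebra_simps)+

end

lift_definition dend_comp :: "nat \<Rightarrow> dend \<Rightarrow> dend \<Rightarrow> dend" is free_comp
proof -
  fix i x x' y y'
  assume "dend_eq x x'" "dend_eq y y'"
  then have "free_comp i (x - x') y + free_comp i x' (y - y') \<in> dend_ideal"
    by (auto simp: dend_eq_def intro: dend_ideal.intros)
  then show "dend_eq (free_comp i x y) (free_comp i x' y')"
    by (simp add: dend_eq_def free_comp_diff_left free_comp_diff_right)
qed

definition Dend :: "dend ns_operad_data" where
  "Dend =
    \<lparr>components = (\<lambda>n. abs_dend ` {x. \<forall>t\<in>Poly_Mapping.keys x. leaves t = n}),
     op_unit = abs_dend (tree_monom Leaf),
     pcomp = (\<lambda>m n i. dend_comp i)\<rparr>"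

definition dend_prec :: dend where "dend_prec = abs_dend (tree_monom (Prec Leaf Leaf))"
definition dend_succ :: dend where "dend_succ = abs_dend (tree_monom (Succ Leaf Leaf))"

definition Dend_sym :: "((nat \<Rightarrow> nat) \<Rightarrow> dend) operad_data" where
  "Dend_sym = symmetrization Dend"


section \<open>The pre-Lie operad\<close>

text \<open>The generator \<open>x\<^sub>2 \<succ> x\<^sub>1 - x\<^sub>1 \<prec> x\<^sub>2\<close>.\<close>

definition prelie_product :: "(nat \<Rightarrow> nat) \<Rightarrow> dend" where
  "prelie_product =
     perm_act Dend_sym 2 (transpose 1 2) (tens dend_succ id) - tens dend_prec id"

definition PreLie :: "((nat \<Rightarrow> nat) \<Rightarrow> dend) operad_data" where
  "PreLie = generated_suboperad Dend_sym (\<lambda>n. if n = 2 then {prelie_product} else {})"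

end

theory Submission
  imports Defs
begin

text \<open>
  The inclusion of \<open>PreLie\<close> into \<open>Dend\<close> can only commute with the actions if the action on
  \<open>PreLie\<close> is the restriction of the one on \<open>Dend\<close>. This gives uniqueness, and reduces existence to
  two assertions: the induced action makes the symmetrization of a non-symmetric anticyclic operad
  an anticyclic operad, and \<open>PreLie(n)\<close> is stable under \<open>\<SS>\<^bsub>n+1\<^esub>\<close>.

  For the first assertion, everything is linear in each argument, so the axioms need only be
  checked on the elements \<open>E \<otimes> \<sigma>\<close>. Each axiom then splits into the corresponding axiom of the
  non-symmetric operad and an identity between permutations. The composite of \<open>E \<otimes> \<sigma>\<close> and \<open>F \<otimes> \<rho>\<close>
  carries the permutation \<open>subst_perm n i \<sigma> \<rho>\<close>, obtained from \<open>\<sigma>\<close> by inflating the point \<open>i\<close> to a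
  block on which \<open>\<rho>\<close> acts; a function is recognised as such a permutation by its values outside the
  block and on the block (\<open>subst_perm_unique\<close>). For the cyclic axioms, write
  \<open>c \<circ> \<sigma> = s \<circ> c\<^sup>j\<close> with \<open>s \<in> \<SS>\<^sub>m\<close> and \<open>0 \<le> j \<le> m\<close>; necessarily \<open>j = \<sigma>\<^sup>-\<^sup>1(1)\<close>. So the long cycle maps \<open>E \<otimes> \<sigma>\<close> to
  \<open>\<tau>\<^sup>j(E) \<otimes> s\<close>, and the axioms amount to computing powers of \<open>\<tau>\<close> on a composite
  \<open>E \<circ>\<^sub>l F\<close>. Viewing \<open>E \<circ>\<^sub>l F\<close> as a planar tree with two inner vertices, \<open>\<tau>\<close> moves the root to the
  next leaf in the plane; the two vertices exchange their roles, with a sign, exactly when the root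
  passes from one vertex to the other
  (\<open>tau_funpow_pcomp_turn\<close>, \<open>tau_funpow_pcomp_widen\<close>).

  For the second assertion, let \<open>S\<close> be the largest family of subspaces of \<open>PreLie\<close> stable under all
  \<open>\<SS>\<^bsub>n+1\<^esub>\<close>. As \<open>\<SS>\<^bsub>n+1\<^esub>\<close> is generated by \<open>\<SS>\<^sub>n\<close> and the long cycle, which turns composites into composites,
  \<open>S\<close> is a suboperad (\<open>suboperad_stable_part\<close>). Hence \<open>S = PreLie\<close> as soon as \<open>S\<close> contains the
  generator, that is, as soon as the rotations of the pre-Lie product stay in \<open>PreLie(2)\<close>. With \<open>p\<close>
  the product and \<open>p'\<close> the opposite product, the long cycle maps \<open>p\<close> to \<open>p' - p\<close> and \<open>p'\<close> to \<open>- p\<close>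
  (\<open>act_long_cycle_products\<close>).
\<close>

section \<open>Substitution of permutations\<close>

text \<open>
  Inflating the point \<open>k\<close> to the block \<open>k, \<dots>, k + n - 1\<close> moves every other point \<open>p\<close> to
  \<open>widen n k p\<close>. Only values at \<open>p \<noteq> k\<close> are meaningful; the points \<open>0\<close> and those beyond the range of a
  permutation are treated uniformly with the others, which in particular includes the root \<open>m + 1\<close>
  of an operation with \<open>m\<close> inputs.
\<close>

definition widen :: "nat \<Rightarrow> nat \<Rightarrow> nat \<Rightarrow> nat" where
  "widen n k p = (if p < k then p else p + n - 1)"

text \<open>
  The permutation carried by \<open>(E \<otimes> \<sigma>) \<circ>\<^sub>i (F \<otimes> \<rho>)\<close>, in a form that makes both equivariance axioms
  instances of the single functoriality law \<open>subst_perm_comp\<close>.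
\<close>

definition subst_perm :: "nat \<Rightarrow> nat \<Rightarrow> (nat \<Rightarrow> nat) \<Rightarrow> (nat \<Rightarrow> nat) \<Rightarrow> nat \<Rightarrow> nat" where
  "subst_perm n i \<sigma> \<rho> p =
     (let k = inv \<sigma> i in
      if k \<le> p \<and> p < k + n then i - 1 + \<rho> (p + 1 - k)
      else widen n i (\<sigma> (if p < k then p else p + 1 - n)))"

text \<open>
  The case distinction behind all identities between permutations below. Knowing a point through its
  preimage \<open>q\<close>, rather than through inequalities, is what allows iterated substitutions to be
  evaluated by rewriting.
\<close>

lemma widen_or_block:
  fixes k n p :: nat
  assumes "1 \<le> k" "1 \<le> n"
  obtains (outside) q where "p = widen n k q" "q \<noteq> k"
    | (block) q where "p = k - 1 + q" "1 \<le> q" "q \<le> n"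
proof -
  consider "p < k" | "k \<le> p" "p < k + n" | "k + n \<le> p" by linarith
  then show ?thesis
  proof cases
    case 1
    then show ?thesis using outside[of p] by (simp add: widen_def)
  next
    case 2
    then show ?thesis using block[of "p + 1 - k"] assms by simp
  next
    case 3
    then show ?thesis using outside[of "p + 1 - n"] assms by (simp add: widen_def)
  qed
qed

lemma permutes_inv_interval:
  assumes "\<sigma> permutes {1..m}" "1 \<le> i" "i \<le> m"
  shows "1 \<le> inv \<sigma> i" "inv \<sigma> i \<le> m" "\<sigma> (inv \<sigma> i) = i"
proof -
  have "inv \<sigma> i \<in> {1..m}"
    using assms permutes_in_image[OF permutes_inv[OF assms(1)], of i] by simp
  then show "1 \<le> inv \<sigma> i" "inv \<sigma> i \<le> m" by simp_all
  show "\<sigma> (inv \<sigma> i) = i" using assms(1) by (simp add: permutes_inverses)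
qed

lemma permutes_interval_image:
  fixes \<sigma> :: "nat \<Rightarrow> nat"
  assumes "\<sigma> permutes {1..m}" "1 \<le> p" "p \<le> m"
  shows "1 \<le> \<sigma> p" "\<sigma> p \<le> m"
  using assms permutes_in_image[OF assms(1), of p] by simp_all

lemma subst_perm_widen:
  assumes "1 \<le> n" "p \<noteq> inv \<sigma> i"
  shows "subst_perm n i \<sigma> \<rho> (widen n (inv \<sigma> i) p) = widen n i (\<sigma> p)"
  using assms by (auto simp: subst_perm_def widen_def Let_def)

lemma subst_perm_block:
  assumes "\<sigma> permutes {1..m}" "1 \<le> i" "i \<le> m" "1 \<le> q" "q \<le> n"
  shows "subst_perm n i \<sigma> \<rho> (inv \<sigma> i - 1 + q) = i - 1 + \<rho> q"
  using permutes_inv_interval[OF assms(1-3)] assms(4,5)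
  by (auto simp: subst_perm_def Let_def)

lemma subst_perm_unique:
  assumes \<sigma>: "\<sigma> permutes {1..m}" "1 \<le> i" "i \<le> m" and n: "1 \<le> n" and k: "k = inv \<sigma> i"
    and outside: "\<And>p. p \<noteq> k \<Longrightarrow> f (widen n k p) = widen n i (\<sigma> p)"
    and block: "\<And>q. 1 \<le> q \<Longrightarrow> q \<le> n \<Longrightarrow> f (k - 1 + q) = i - 1 + \<rho> q"
  shows "f = subst_perm n i \<sigma> \<rho>"
proof
  fix p
  have "1 \<le> k" using permutes_inv_interval[OF \<sigma>] k by simp
  then show "f p = subst_perm n i \<sigma> \<rho> p" using n
  proof (cases rule: widen_or_block[where p = p])
    case (outside q)
    then show ?thesis using subst_perm_widen[OF n, of q \<sigma> i \<rho>] assms(6)[of q] k by simp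
  next
    case (block q)
    then show ?thesis using subst_perm_block[OF \<sigma>, of q n \<rho>] assms(7)[of q] k by simp
  qed
qed

lemma subst_perm_id:
  assumes "1 \<le> i" "1 \<le> n"
  shows "subst_perm n i id id = id"
  by (rule sym, rule subst_perm_unique[of id i]) (use assms permutes_id in auto)

text \<open>
  Substitution is functorial: a block is permuted first by \<open>\<theta>\<close> and transported as a whole by \<open>\<pi>\<close>, and
  lands on the block treated by \<open>\<sigma>\<close> and \<open>\<rho>\<close>. Invertibility of \<open>subst_perm\<close> and both
  equivariance axioms follow.
\<close>

lemma subst_perm_comp:
  assumes \<sigma>: "\<sigma> permutes {1..m}" "1 \<le> i" "i \<le> m" and \<pi>: "\<pi> permutes {1..m}"
    and \<theta>: "\<theta> permutes {1..n}" and n: "1 \<le> n"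
  shows "subst_perm n i \<sigma> \<rho> \<circ> subst_perm n (inv \<sigma> i) \<pi> \<theta> = subst_perm n i (\<sigma> \<circ> \<pi>) (\<rho> \<circ> \<theta>)"
proof -
  define k where "k = inv \<sigma> i"
  have k: "1 \<le> k" "k \<le> m" using permutes_inv_interval[OF \<sigma>] by (simp_all add: k_def)
  have inv: "inv \<pi> k = inv (\<sigma> \<circ> \<pi>) i"
    using \<sigma>(1) \<pi> by (simp add: k_def o_inv_distrib permutes_bij)
  have "\<pi> p \<noteq> k" if "p \<noteq> inv \<pi> k" for p
    using that \<pi> by (metis permutes_inverses(2))
  then have "subst_perm n i \<sigma> \<rho> (subst_perm n k \<pi> \<theta> (widen n (inv \<pi> k) p)) = widen n i (\<sigma> (\<pi> p))"
    if "p \<noteq> inv \<pi> k" for p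
    using that n by (simp add: subst_perm_widen k_def)
  moreover have "subst_perm n i \<sigma> \<rho> (subst_perm n k \<pi> \<theta> (inv \<pi> k - 1 + q)) = i - 1 + \<rho> (\<theta> q)"
    if "1 \<le> q" "q \<le> n" for q
    using subst_perm_block[OF \<pi> k that, of \<theta>] permutes_interval_image[OF \<theta> that]
      subst_perm_block[OF \<sigma>, of "\<theta> q" n \<rho>] by (simp add: k_def)
  ultimately show ?thesis
    using subst_perm_unique[OF permutes_compose[OF \<pi> \<sigma>(1)] \<sigma>(2,3) n inv]
    by (simp add: k_def)
qed

lemma subst_perm_permutes:
  assumes \<sigma>: "\<sigma> permutes {1..m}" "1 \<le> i" "i \<le> m" and \<rho>: "\<rho> permutes {1..n}" and n: "1 \<le> n"
  shows "subst_perm n i \<sigma> \<rho> permutes {1..m + n - 1}"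
proof -
  define k where "k = inv \<sigma> i"
  have k: "1 \<le> k" "k \<le> m" "\<sigma> k = i" using permutes_inv_interval[OF \<sigma>] by (simp_all add: k_def)
  have inv: "inv (inv \<sigma>) k = i" using \<sigma>(1) k by (simp add: permutes_inv_inv)
  let ?f = "subst_perm n i \<sigma> \<rho>" and ?g = "subst_perm n k (inv \<sigma>) (inv \<rho>)"
  have "?f \<circ> ?g = id"
    using subst_perm_comp[OF \<sigma> permutes_inv[OF \<sigma>(1)] permutes_inv[OF \<rho>] n, of \<rho>] \<sigma> \<rho> n
    by (simp add: k_def permutes_inv_o subst_perm_id)
  moreover have "?g \<circ> ?f = id"
    using subst_perm_comp[OF permutes_inv[OF \<sigma>(1)] k(1,2) \<sigma>(1) \<rho> n, of "inv \<rho>"] \<sigma> \<rho> n k inv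
    by (simp add: permutes_inv_o subst_perm_id)
  ultimately have bij: "bij ?f" by (rule o_bij[rotated])
  have "?f p = p" if "p \<notin> {1..m + n - 1}" for p
  proof -
    consider "p = 0" | "m + n \<le> p" using \<open>p \<notin> _\<close> by fastforce
    then show ?thesis
    proof cases
      case 1
      then show ?thesis
        using k \<sigma> by (simp add: subst_perm_def k_def[symmetric] widen_def permutes_not_in[OF \<sigma>(1)])
    next
      case 2
      then show ?thesis
        using k \<sigma> n permutes_not_in[OF \<sigma>(1), of "p + 1 - n"]
        by (simp add: subst_perm_def k_def[symmetric] widen_def Let_def) linarith
    qed
  qed
  with bij show ?thesis by (simp add: permutes_def bij_iff)
qed

text \<open>
  Identifies the permutation in the composition of the symmetrization with \<open>subst_perm\<close>.
\<close>

lemma block_perm_comp_shift_perm: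
  assumes \<sigma>: "\<sigma> permutes {1..m}" "1 \<le> i" "i \<le> m" and \<rho>: "\<rho> permutes {1..n}" and n: "1 \<le> n"
  shows "block_perm m n i \<sigma> \<circ> shift_perm n (inv \<sigma> i) \<rho> = subst_perm n i \<sigma> \<rho>"
proof (rule subst_perm_unique[OF \<sigma> n refl])
  let ?k = "inv \<sigma> i"
  note k = permutes_inv_interval[OF \<sigma>]
  show "(block_perm m n i \<sigma> \<circ> shift_perm n ?k \<rho>) (widen n ?k p) = widen n i (\<sigma> p)"
    if "p \<noteq> ?k" for p
  proof -
    have shift: "shift_perm n ?k \<rho> (widen n ?k p) = widen n ?k p"
      using that by (auto simp: shift_perm_def widen_def)
    consider "p = 0" | "1 \<le> p" "p \<le> m" | "m < p" by linarith
    then show ?thesis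
    proof cases
      case 1
      then show ?thesis
        using \<sigma> k permutes_not_in[OF \<sigma>(1), of 0] unfolding comp_def shift
        by (simp add: block_perm_def widen_def Let_def)
    next
      case 2
      then show ?thesis
        using \<sigma> k that n unfolding comp_def shift
        by (auto simp: block_perm_def widen_def Let_def)
    next
      case 3
      then show ?thesis
        using \<sigma> k n permutes_not_in[OF \<sigma>(1), of p] unfolding comp_def shift
        by (auto simp: block_perm_def widen_def Let_def)
    qed
  qed
  show "(block_perm m n i \<sigma> \<circ> shift_perm n ?k \<rho>) (?k - 1 + q) = i - 1 + \<rho> q"
    if "1 \<le> q" "q \<le> n" for q
    using k \<sigma> n that permutes_interval_image[OF \<rho> that]
    by (auto simp: block_perm_def shift_perm_def Let_def)
qed

lemma inv_subst_perm_block: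
  assumes \<sigma>: "\<sigma> permutes {1..m}" "1 \<le> i" "i \<le> m" and \<rho>: "\<rho> permutes {1..n}" "1 \<le> j" "j \<le> n"
  shows "inv (subst_perm n i \<sigma> \<rho>) (i - 1 + j) = inv \<sigma> i - 1 + inv \<rho> j"
proof -
  have "subst_perm n i \<sigma> \<rho> (inv \<sigma> i - 1 + inv \<rho> j) = i - 1 + j"
    using subst_perm_block[OF \<sigma>] permutes_inv_interval[OF \<rho>] by simp
  then show ?thesis
    using subst_perm_permutes[OF \<sigma> \<rho>(1)] \<rho> by (metis le_trans permutes_inverses(2))
qed

lemma inv_subst_perm_widen:
  assumes \<sigma>: "\<sigma> permutes {1..m}" "1 \<le> i" "i \<le> m" and \<rho>: "\<rho> permutes {1..n}" and n: "1 \<le> n"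
    and "j \<noteq> i"
  shows "inv (subst_perm n i \<sigma> \<rho>) (widen n i j) = widen n (inv \<sigma> i) (inv \<sigma> j)"
proof -
  have "inv \<sigma> j \<noteq> inv \<sigma> i" using \<sigma>(1) \<open>j \<noteq> i\<close> by (metis permutes_inverses(1))
  then have "subst_perm n i \<sigma> \<rho> (widen n (inv \<sigma> i) (inv \<sigma> j)) = widen n i j"
    using subst_perm_widen[OF n] \<sigma>(1) by (simp add: permutes_inverses)
  then show ?thesis
    using subst_perm_permutes[OF \<sigma> \<rho> n] by (metis permutes_inverses(2))
qed

text \<open>
  The inner block of \<open>\<theta>\<close> lies inside the block of \<open>\<rho>\<close>. Outside the outer block, inflating by \<open>n\<close> and
  then by \<open>l\<close> is inflating once by \<open>n + l - 1\<close>; inside it, both sides are the substitution of \<open>\<theta>\<close> in \<open>\<rho>\<close>.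
\<close>

lemma subst_perm_assoc_sequential:
  assumes \<sigma>: "\<sigma> permutes {1..m}" "1 \<le> i" "i \<le> m" and \<rho>: "\<rho> permutes {1..n}" "1 \<le> j" "j \<le> n"
    and \<theta>: "\<theta> permutes {1..l}" and l: "1 \<le> l"
  shows "subst_perm l (i - 1 + j) (subst_perm n i \<sigma> \<rho>) \<theta>
       = subst_perm (n + l - 1) i \<sigma> (subst_perm l j \<rho> \<theta>)" (is "?f = _")
proof (rule subst_perm_unique[OF \<sigma> _ refl])
  have n: "1 \<le> n" using \<rho> by simp
  then show "1 \<le> n + l - 1" using l by simp
  define k h where "k = inv \<sigma> i" and "h = inv \<rho> j"
  have k: "1 \<le> k" "k \<le> m" "\<sigma> k = i" using permutes_inv_interval[OF \<sigma>] by (simp_all add: k_def)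
  have h: "1 \<le> h" "h \<le> n" "\<rho> h = j" using permutes_inv_interval[OF \<rho>] by (simp_all add: h_def)
  let ?\<kappa> = "subst_perm n i \<sigma> \<rho>"
  have inv: "inv ?\<kappa> (i - 1 + j) = k - 1 + h"
    using inv_subst_perm_block[OF \<sigma> \<rho>] by (simp add: k_def h_def)
  have \<kappa>: "?\<kappa> permutes {1..m + n - 1}" "1 \<le> i - 1 + j" "i - 1 + j \<le> m + n - 1"
    using subst_perm_permutes[OF \<sigma> \<rho>(1) n] \<sigma> \<rho> by auto
  have f_widen: "?f (widen l (k - 1 + h) p) = widen l (i - 1 + j) (?\<kappa> p)" if "p \<noteq> k - 1 + h" for p
    using subst_perm_widen[OF l, of p ?\<kappa> "i - 1 + j"] that inv by simp
  show "?f (widen (n + l - 1) (inv \<sigma> i) p) = widen (n + l - 1) i (\<sigma> p)"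
    if p: "p \<noteq> inv \<sigma> i" for p
  proof -
    have "\<sigma> p \<noteq> i" using \<sigma>(1) p by (metis permutes_inverses(2))
    have "widen (n + l - 1) k p = widen l (k - 1 + h) (widen n k p)" "widen n k p \<noteq> k - 1 + h"
      using k h n l p by (auto simp: widen_def k_def[symmetric])
    then have "?f (widen (n + l - 1) k p) = widen l (i - 1 + j) (widen n i (\<sigma> p))"
      using f_widen subst_perm_widen[OF n p, of \<rho>] by (simp add: k_def)
    also have "\<dots> = widen (n + l - 1) i (\<sigma> p)"
      using \<open>\<sigma> p \<noteq> i\<close> \<sigma> \<rho> n l by (auto simp: widen_def)
    finally show ?thesis by (simp add: k_def)
  qed
  show "?f (inv \<sigma> i - 1 + q) = i - 1 + subst_perm l j \<rho> \<theta> q"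
    if q: "1 \<le> q" "q \<le> n + l - 1" for q
    using h(1) l
  proof (cases rule: widen_or_block[where p = q])
    case (outside r)
    have r: "1 \<le> r" "r \<le> n" using outside q h l by (auto simp: widen_def split: if_splits)
    have "\<rho> r \<noteq> j" using outside(2) \<rho>(1) h by (metis permutes_inverses(2) h_def)
    have "k - 1 + q = widen l (k - 1 + h) (k - 1 + r)" "k - 1 + r \<noteq> k - 1 + h"
      using outside k h r l by (auto simp: widen_def)
    then have "?f (k - 1 + q) = widen l (i - 1 + j) (i - 1 + \<rho> r)"
      using f_widen subst_perm_block[OF \<sigma> r, of \<rho>] by (simp add: k_def)
    also have "\<dots> = i - 1 + widen l j (\<rho> r)"
      using l by (auto simp: widen_def)
    also have "widen l j (\<rho> r) = subst_perm l j \<rho> \<theta> q"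
      using subst_perm_widen[OF l, of r \<rho> j \<theta>] outside by (simp add: h_def)
    finally show ?thesis by (simp add: k_def)
  next
    case (block r)
    have "k - 1 + q = k - 1 + h - 1 + r" using block h by simp
    then have "?f (k - 1 + q) = i - 1 + j - 1 + \<theta> r"
      using subst_perm_block[OF \<kappa> block(2,3), of \<theta>] inv by simp
    also have "\<dots> = i - 1 + (j - 1 + \<theta> r)" using \<rho> by simp
    also have "j - 1 + \<theta> r = subst_perm l j \<rho> \<theta> q"
      using subst_perm_block[OF \<rho> block(2,3), of \<theta>] block by (simp add: h_def)
    finally show ?thesis by (simp add: k_def)
  qed
qed

text \<open>
  Two disjoint blocks are inflated in either order. Stated with \<open>widen\<close>, the claim is symmetric in the
  two blocks, so that it covers both possible orders of the points \<open>\<sigma>\<^sup>-\<^sup>1(i)\<close> and \<open>\<sigma>\<^sup>-\<^sup>1(j)\<close>.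
\<close>

lemma subst_perm_assoc_parallel:
  assumes \<sigma>: "\<sigma> permutes {1..m}" and i: "1 \<le> i" "i \<le> m" and j: "1 \<le> j" "j \<le> m" and "i \<noteq> j"
    and \<rho>: "\<rho> permutes {1..n}" "1 \<le> n" and \<theta>: "\<theta> permutes {1..l}" "1 \<le> l"
  shows "subst_perm l (widen n i j) (subst_perm n i \<sigma> \<rho>) \<theta>
       = subst_perm n (widen l j i) (subst_perm l j \<sigma> \<theta>) \<rho>" (is "?f = _")
proof -
  define k h where "k = inv \<sigma> i" and "h = inv \<sigma> j"
  have k: "1 \<le> k" "k \<le> m" "\<sigma> k = i" using permutes_inv_interval[OF \<sigma> i] by (simp_all add: k_def)
  have h: "1 \<le> h" "h \<le> m" "\<sigma> h = j" using permutes_inv_interval[OF \<sigma> j] by (simp_all add: h_def)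
  have "h \<noteq> k" using \<open>i \<noteq> j\<close> k h by auto
  let ?\<kappa> = "subst_perm n i \<sigma> \<rho>" and ?\<mu> = "subst_perm l j \<sigma> \<theta>"
  have inv\<kappa>: "inv ?\<kappa> (widen n i j) = widen n k h"
    using inv_subst_perm_widen[OF \<sigma> i \<rho>, of j] \<open>i \<noteq> j\<close> by (simp add: k_def h_def)
  have inv\<mu>: "inv ?\<mu> (widen l j i) = widen l h k"
    using inv_subst_perm_widen[OF \<sigma> j \<theta>, of i] \<open>i \<noteq> j\<close> by (simp add: k_def h_def)
  have \<kappa>: "?\<kappa> permutes {1..m + n - 1}" "1 \<le> widen n i j" "widen n i j \<le> m + n - 1"
    using subst_perm_permutes[OF \<sigma> i \<rho>] j \<rho> by (auto simp: widen_def)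
  have \<mu>: "?\<mu> permutes {1..m + l - 1}" "1 \<le> widen l j i" "widen l j i \<le> m + l - 1"
    using subst_perm_permutes[OF \<sigma> j \<theta>] i \<theta> by (auto simp: widen_def)
  have f_widen: "?f (widen l (widen n k h) p) = widen l (widen n i j) (?\<kappa> p)"
    if "p \<noteq> widen n k h" for p
    using subst_perm_widen[OF \<theta>(2), of p ?\<kappa> "widen n i j"] that inv\<kappa> by simp
  have comm: "widen n (widen l b a) (widen l b p) = widen l (widen n a b) (widen n a p)"
    if "a \<noteq> b" "p \<noteq> a" "p \<noteq> b" for a b p
    using that \<rho>(2) \<theta>(2) by (auto simp: widen_def)
  show ?thesis
  proof (rule subst_perm_unique[OF \<mu> \<rho>(2) inv\<mu>[symmetric]])
    fix p assume p: "p \<noteq> widen l h k"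
    show "?f (widen n (widen l h k) p) = widen n (widen l j i) (?\<mu> p)"
      using h(1) \<theta>(2)
    proof (cases rule: widen_or_block[where p = p])
      case (outside q)
      have q: "q \<noteq> k" "q \<noteq> h" using outside p by auto
      then have \<sigma>q: "\<sigma> q \<noteq> i" "\<sigma> q \<noteq> j"
        using \<sigma> by (metis k_def h_def permutes_inverses(2))+
      have "widen n k q \<noteq> widen n k h" using q \<open>h \<noteq> k\<close> \<rho>(2) by (auto simp: widen_def)
      then have "?f (widen n (widen l h k) p) = widen l (widen n i j) (widen n i (\<sigma> q))"
        using f_widen comm[of k h q] q \<open>h \<noteq> k\<close> subst_perm_widen[OF \<rho>(2), of q \<sigma> i \<rho>]
        by (simp add: outside k_def)
      also have "\<dots> = widen n (widen l j i) (widen l j (\<sigma> q))"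
        using comm[of i j "\<sigma> q"] \<sigma>q \<open>i \<noteq> j\<close> by simp
      finally show ?thesis
        using subst_perm_widen[OF \<theta>(2), of q \<sigma> j \<theta>] outside by (simp add: h_def)
    next
      case (block r)
      have "widen n (widen l h k) p = widen n k h - 1 + r"
        using block \<open>h \<noteq> k\<close> h k \<rho>(2) by (auto simp: widen_def)
      then have "?f (widen n (widen l h k) p) = widen n i j - 1 + \<theta> r"
        using subst_perm_block[OF \<kappa> block(2,3), of \<theta>] inv\<kappa> by simp
      also have "\<dots> = widen n (widen l j i) (j - 1 + \<theta> r)"
        using \<open>i \<noteq> j\<close> i j \<rho>(2) permutes_interval_image[OF \<theta>(1) block(2,3)] by (auto simp: widen_def)
      finally show ?thesis
        using subst_perm_block[OF \<sigma> j block(2,3), of \<theta>] block by (simp add: h_def)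
    qed
  next
    fix q assume q: "1 \<le> q" "q \<le> n"
    have "widen l h k - 1 + q = widen l (widen n k h) (k - 1 + q)" "k - 1 + q \<noteq> widen n k h"
      using q \<open>h \<noteq> k\<close> h k \<theta>(2) by (auto simp: widen_def)
    then have "?f (widen l h k - 1 + q) = widen l (widen n i j) (i - 1 + \<rho> q)"
      using f_widen subst_perm_block[OF \<sigma> i q, of \<rho>] by (simp add: k_def)
    also have "\<dots> = widen l j i - 1 + \<rho> q"
      using \<open>i \<noteq> j\<close> i j \<theta>(2) permutes_interval_image[OF \<rho>(1) q] by (auto simp: widen_def)
    finally show "?f (widen l h k - 1 + q) = widen l j i - 1 + \<rho> q" .
  qed
qed

section \<open>Powers of the long cycle\<close>

text \<open>
  The value \<open>k = n + 1\<close> is included since the decomposition of a permutation of \<open>{1..n + 1}\<close> fixing \<open>n + 1\<close>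
  produces this exponent.
\<close>

lemma long_cycle_funpow:
  "k \<le> n + 1 \<Longrightarrow> (long_cycle n ^^ k) p =
     (if p = 0 \<or> n + 1 < p then p else if k < p then p - k else p + n + 1 - k)"
proof (induction k)
  case (Suc k)
  then have "(long_cycle n ^^ Suc k) p = long_cycle n
      (if p = 0 \<or> n + 1 < p then p else if k < p then p - k else p + n + 1 - k)"
    by simp
  also have "\<dots> = (if p = 0 \<or> n + 1 < p then p else if Suc k < p then p - Suc k else p + n + 1 - Suc k)"
    using Suc.prems by (auto simp: long_cycle_def)
  finally show ?case .
qed simp

lemma long_cycle_order: "long_cycle n ^^ (n + 1) = id"
  by (rule ext, subst long_cycle_funpow) auto

lemma long_cycle_permutes: "long_cycle n permutes {1..n + 1}"
proof -
  have "long_cycle n \<circ> long_cycle n ^^ n = id" "long_cycle n ^^ n \<circ> long_cycle n = id"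
    using long_cycle_order[of n] by (simp_all add: funpow_swap1 fun_eq_iff)
  then have "bij (long_cycle n)" by (rule o_bij[rotated])
  then show ?thesis by (auto simp: permutes_def bij_iff long_cycle_def)
qed

lemma long_cycle_funpow_permutes: "long_cycle n ^^ k permutes {1..n + 1}"
  by (induction k) (simp_all only: funpow.simps permutes_id permutes_compose[OF _ long_cycle_permutes])

text \<open>
  The exponent must send the preimage of \<open>n + 1\<close> back to \<open>n + 1\<close>, and \<open>c\<^sup>r(r) = n + 1\<close>. The exponent is
  thus the preimage itself.
\<close>

lemma permutes_decomposition:
  assumes \<pi>: "\<pi> permutes {1..n + 1}"
  obtains s where "s permutes {1..n}" "\<pi> = s \<circ> long_cycle n ^^ inv \<pi> (n + 1)"
proof -
  define r where "r = inv \<pi> (n + 1)"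
  have r: "1 \<le> r" "r \<le> n + 1" "\<pi> r = n + 1"
    using permutes_inv_interval[OF \<pi>, of "n + 1"] by (simp_all add: r_def)
  define c where "c = long_cycle n ^^ r"
  have c: "c permutes {1..n + 1}" unfolding c_def by (rule long_cycle_funpow_permutes)
  have "c r = n + 1" using r by (simp add: c_def long_cycle_funpow)
  then have "inv c (n + 1) = r" using c by (metis permutes_inverses(2))
  then have "(\<pi> \<circ> inv c) (n + 1) = n + 1" using r by simp
  moreover have "\<pi> \<circ> inv c permutes {1..n + 1}" by (rule permutes_compose[OF permutes_inv[OF c] \<pi>])
  ultimately have "\<pi> \<circ> inv c permutes {1..n}"
    by (rule_tac permutes_superset) (auto simp: le_Suc_eq)
  moreover have "\<pi> = (\<pi> \<circ> inv c) \<circ> c"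
    using c by (simp add: comp_assoc permutes_inv_o)
  ultimately show ?thesis using that by (simp only: c_def r_def)
qed

lemma permutes_decomposition_unique:
  assumes s: "s permutes {1..n}" "s' permutes {1..n}" and k: "k \<le> n" "k' \<le> n"
    and eq: "s \<circ> long_cycle n ^^ k = s' \<circ> long_cycle n ^^ k'"
  shows "s = s'" "k = k'"
proof -
  define x where "x = (if k = 0 then n + 1 else k)"
  have "(long_cycle n ^^ k) x = n + 1" using k by (auto simp: x_def long_cycle_funpow)
  then have "s' ((long_cycle n ^^ k') x) = n + 1"
    using eq permutes_not_in[OF s(1), of "n + 1"]
    by (metis atLeastAtMost_iff comp_apply not_less_eq_eq order_refl Suc_eq_plus1)
  then have "(long_cycle n ^^ k') x = n + 1"
    using permutes_not_in[OF s(2), of "n + 1"] s(2)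
    by (metis atLeastAtMost_iff not_less_eq_eq order_refl Suc_eq_plus1 permutes_inverses(2))
  then show "k = k'" using k by (auto simp: x_def long_cycle_funpow split: if_splits)
  then have "s \<circ> (long_cycle n ^^ k \<circ> inv (long_cycle n ^^ k))
      = s' \<circ> (long_cycle n ^^ k \<circ> inv (long_cycle n ^^ k))"
    using eq by (simp only: comp_assoc[symmetric])
  then show "s = s'" by (simp only: permutes_inv_o[OF long_cycle_funpow_permutes] comp_id)
qed

text \<open>
  The rotation that brings the input \<open>j\<close> to the root position commutes with inflating another input
  \<open>l\<close>: after inflation the input to be brought there is \<open>widen n l j\<close>.
\<close>

lemma long_cycle_funpow_widen:
  assumes l: "1 \<le> l" "l \<le> m" and j: "1 \<le> j" "j \<le> m" and "l \<noteq> j" and n: "1 \<le> n" and "q \<noteq> l"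
  shows "(long_cycle (m + n - 1) ^^ widen n l j) (widen n l q)
       = widen n ((long_cycle m ^^ j) l) ((long_cycle m ^^ j) q)"
proof -
  have K: "widen n l j \<le> m + n - 1 + 1"
    using j n by (simp add: widen_def, arith)
  have rot_l: "(long_cycle m ^^ j) l = (if j < l then l - j else l + m + 1 - j)"
    using long_cycle_funpow[of j m l] l j by simp
  consider "q = 0 \<or> m + 1 < q" | "1 \<le> q" "q \<le> m + 1" by linarith
  then show ?thesis
  proof cases
    case 1
    then have "widen n l q = 0 \<or> m + n < widen n l q" using l n by (auto simp: widen_def)
    then have "(long_cycle (m + n - 1) ^^ widen n l j) (widen n l q) = widen n l q"
      using long_cycle_funpow[OF K] n by auto
    moreover have "(long_cycle m ^^ j) q = q"
      using long_cycle_funpow[of j m q] j 1 by auto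
    ultimately show ?thesis
      using 1 l j \<open>l \<noteq> j\<close> by (auto simp: rot_l widen_def)
  next
    case 2
    have rot_q: "(long_cycle m ^^ j) q = (if j < q then q - j else q + m + 1 - j)"
      using long_cycle_funpow[of j m q] j 2 by simp
    have "1 \<le> widen n l q" "widen n l q \<le> m + n"
      using 2 l n \<open>q \<noteq> l\<close> by (simp_all add: widen_def, arith+)
    then have "(long_cycle (m + n - 1) ^^ widen n l j) (widen n l q)
        = (if widen n l j < widen n l q then widen n l q - widen n l j
           else widen n l q + (m + n) - widen n l j)"
      using long_cycle_funpow[OF K] n by auto
    moreover obtain d where d: "n = Suc d" using n by (cases n) auto
    moreover obtain e where e: "m = j + e" using j(2) by (auto simp: le_iff_add)
    moreover note eq = calculation
    show ?thesis
    proof (cases "j < l")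
      case True
      then obtain a where a: "l = Suc (j + a)" using less_imp_Suc_add by blast
      show ?thesis
      proof (cases "j < q")
        case True
        then obtain b where "q = Suc (j + b)" using less_imp_Suc_add by blast
        then show ?thesis unfolding eq(1) rot_l rot_q using \<open>q \<noteq> l\<close> by (simp add: a d e widen_def)
      next
        case False
        then obtain b where "j = q + b" by (auto simp: not_less le_iff_add)
        then show ?thesis unfolding eq(1) rot_l rot_q using 2(1) l(2) by (simp add: a d e widen_def)
      qed
    next
      case False
      then obtain a where a: "j = Suc (l + a)" using less_imp_Suc_add[of l j] \<open>l \<noteq> j\<close> by auto
      show ?thesis
      proof (cases "j < q")
        case True
        then obtain b where "q = Suc (j + b)" using less_imp_Suc_add by blast
        then show ?thesis unfolding eq(1) rot_l rot_q using 2(2) l by (simp add: a d e widen_def)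
      next
        case False
        then obtain b where "j = q + b" by (auto simp: not_less le_iff_add)
        then have "(l < q \<or> q < l) \<and> Suc (l + a) = q + b" using a \<open>q \<noteq> l\<close> by auto
        then show ?thesis
          unfolding eq(1) rot_l rot_q using 2 l by (auto simp add: a d e widen_def)
      qed
    qed
  qed
qed

lemma long_cycle_funpow_block:
  assumes l: "1 \<le> l" "l \<le> m" and j: "1 \<le> j" "j \<le> m" and "l \<noteq> j" and q: "1 \<le> q" "q \<le> n"
  shows "(long_cycle (m + n - 1) ^^ widen n l j) (l - 1 + q) = (long_cycle m ^^ j) l - 1 + q"
proof -
  have K: "widen n l j \<le> m + n - 1 + 1"
    using j q by (simp add: widen_def, arith)
  have rot_l: "(long_cycle m ^^ j) l = (if j < l then l - j else l + m + 1 - j)"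
    using long_cycle_funpow[of j m l] l j by simp
  have bounds: "\<not> (l - 1 + q = 0 \<or> m + n - 1 + 1 < l - 1 + q)" "m + n - 1 + 1 = m + n"
    using l q by arith+
  have "(long_cycle (m + n - 1) ^^ widen n l j) (l - 1 + q)
      = (if widen n l j < l - 1 + q then l - 1 + q - widen n l j else l - 1 + q + (m + n) - widen n l j)"
    using bounds long_cycle_funpow[OF K, of "l - 1 + q"] by (simp only: if_False simp_thms) simp
  moreover obtain d where d: "n = Suc d" using q by (cases n) auto
  moreover obtain e where e: "m = j + e" using j(2) by (auto simp: le_iff_add)
  moreover note eq = calculation
  show ?thesis
  proof (cases "j < l")
    case True
    then obtain a where "l = Suc (j + a)" using less_imp_Suc_add by blast
    then show ?thesis using q unfolding eq(1) rot_l by (simp add: d e widen_def)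
  next
    case False
    then obtain b where "j = Suc (l + b)" using less_imp_Suc_add[of l j] \<open>l \<noteq> j\<close> by auto
    then show ?thesis using l(1) q unfolding eq(1) rot_l by (simp add: d e widen_def)
  qed
qed

text \<open>
  The permutation part of \<open>\<tau>(f \<circ>\<^sub>i g) = \<tau>(f) \<circ>\<^bsub>i-1\<^esub> g\<close>: the input that becomes the root lies outside the
  inserted block.
\<close>

lemma long_cycle_comp_subst_perm:
  assumes \<sigma>: "\<sigma> permutes {1..m}" and i: "2 \<le> i" "i \<le> m" and \<rho>: "\<rho> permutes {1..n}" and n: "1 \<le> n"
    and s: "s permutes {1..m}" "long_cycle m \<circ> \<sigma> = s \<circ> long_cycle m ^^ inv \<sigma> 1"
  shows "inv s (i - 1) = (long_cycle m ^^ inv \<sigma> 1) (inv \<sigma> i)"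
    and "long_cycle (m + n - 1) \<circ> subst_perm n i \<sigma> \<rho>
       = subst_perm n (i - 1) s \<rho> \<circ> long_cycle (m + n - 1) ^^ widen n (inv \<sigma> i) (inv \<sigma> 1)"
proof -
  define j l where "j = inv \<sigma> 1" and "l = inv \<sigma> i"
  have j: "1 \<le> j" "j \<le> m" "\<sigma> j = 1" and l: "1 \<le> l" "l \<le> m" "\<sigma> l = i"
    using permutes_inv_interval[OF \<sigma>] i by (simp_all add: j_def l_def)
  have "l \<noteq> j" using i j l by auto
  let ?c = "long_cycle m ^^ j"
  have s': "s (?c q) = long_cycle m (\<sigma> q)" for q
    using fun_cong[OF s(2), of q] by (simp add: j_def)
  have "long_cycle m i = i - 1" using i by (simp add: long_cycle_def)
  then have "s (?c l) = i - 1" using s'[of l] l by simp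
  then have inv: "inv s (i - 1) = ?c l" using s(1) by (metis permutes_inverses(2))
  then show "inv s (i - 1) = (long_cycle m ^^ inv \<sigma> 1) (inv \<sigma> i)" by (simp add: j_def l_def)
  show "long_cycle (m + n - 1) \<circ> subst_perm n i \<sigma> \<rho>
       = subst_perm n (i - 1) s \<rho> \<circ> long_cycle (m + n - 1) ^^ widen n (inv \<sigma> i) (inv \<sigma> 1)"
  proof
    fix x
    show "(long_cycle (m + n - 1) \<circ> subst_perm n i \<sigma> \<rho>) x
       = (subst_perm n (i - 1) s \<rho> \<circ> long_cycle (m + n - 1) ^^ widen n (inv \<sigma> i) (inv \<sigma> 1)) x"
      using l(1) n
    proof (cases rule: widen_or_block[where p = x])
      case (outside q)
      have "\<sigma> q \<noteq> i"
        using outside(2) l inj_eq[OF permutes_inj[OF \<sigma>], of q l] by simp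
      have "?c q \<noteq> ?c l"
        using outside(2) inj_eq[OF permutes_inj[OF long_cycle_funpow_permutes[of j m]], of q l] by simp
      have "(long_cycle (m + n - 1) \<circ> subst_perm n i \<sigma> \<rho>) x
          = long_cycle (m + n - 1) (widen n i (\<sigma> q))"
        using outside subst_perm_widen[OF n, of q \<sigma> i \<rho>] by (simp add: l_def)
      also have "\<dots> = widen n (i - 1) (long_cycle m (\<sigma> q))"
        using \<open>\<sigma> q \<noteq> i\<close> i n by (cases n) (auto simp: widen_def long_cycle_def)
      also have "\<dots> = subst_perm n (i - 1) s \<rho> (widen n (?c l) (?c q))"
        using subst_perm_widen[OF n, of "?c q" s "i - 1" \<rho>] inv \<open>?c q \<noteq> ?c l\<close> by (simp add: s')
      finally show ?thesis
        using long_cycle_funpow_widen[OF l(1,2) j(1,2) \<open>l \<noteq> j\<close> n outside(2)] outside(1)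
        by (simp add: j_def l_def)
    next
      case (block q)
      have i1: "1 \<le> i - 1" "i - 1 \<le> m" using i by auto
      have "(long_cycle (m + n - 1) \<circ> subst_perm n i \<sigma> \<rho>) x
          = long_cycle (m + n - 1) (i - 1 + \<rho> q)"
        using block subst_perm_block[OF \<sigma> _ i(2) block(2,3), of \<rho>] i by (simp add: l_def)
      also have "\<dots> = i - 1 - 1 + \<rho> q"
        using i permutes_interval_image[OF \<rho> block(2,3)]
        by (cases i; cases "i - 1") (simp_all add: long_cycle_def)
      also have "\<dots> = subst_perm n (i - 1) s \<rho> (?c l - 1 + q)"
        using subst_perm_block[OF s(1) i1 block(2,3), of \<rho>] inv by simp
      finally show ?thesis
        using long_cycle_funpow_block[OF l(1,2) j(1,2) \<open>l \<noteq> j\<close> block(2,3)] block(1)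
        by (simp add: j_def l_def)
    qed
  qed
qed

text \<open>
  The permutation part of \<open>\<tau>(f \<circ>\<^sub>1 g) = - \<tau>(g) \<circ>\<^sub>n \<tau>(f)\<close>: the input that becomes the root lies in the
  inserted block, so that \<open>\<rho>\<close> gives rise to the outer permutation \<open>t\<close> and \<open>\<sigma>\<close> to the inserted one \<open>s\<close>.
\<close>

lemma long_cycle_comp_subst_perm_first:
  assumes \<sigma>: "\<sigma> permutes {1..m}" and m: "1 \<le> m" and \<rho>: "\<rho> permutes {1..n}" and n: "1 \<le> n"
    and s: "s permutes {1..m}" "long_cycle m \<circ> \<sigma> = s \<circ> long_cycle m ^^ inv \<sigma> 1"
    and t: "t permutes {1..n}" "long_cycle n \<circ> \<rho> = t \<circ> long_cycle n ^^ inv \<rho> 1"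
  shows "inv t n = n + 1 - inv \<rho> 1"
    and "long_cycle (m + n - 1) \<circ> subst_perm n 1 \<sigma> \<rho>
       = subst_perm m n t s \<circ> long_cycle (m + n - 1) ^^ (inv \<sigma> 1 - 1 + inv \<rho> 1)"
proof -
  define j p where "j = inv \<sigma> 1" and "p = inv \<rho> 1"
  have j: "1 \<le> j" "j \<le> m" "\<sigma> j = 1" and p: "1 \<le> p" "p \<le> n" "\<rho> p = 1"
    using permutes_inv_interval[OF \<sigma>] permutes_inv_interval[OF \<rho>] m n by (simp_all add: j_def p_def)
  have s': "s ((long_cycle m ^^ j) q) = long_cycle m (\<sigma> q)" for q
    using fun_cong[OF s(2), of q] by (simp add: j_def)
  have t': "t ((long_cycle n ^^ p) q) = long_cycle n (\<rho> q)" for q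
    using fun_cong[OF t(2), of q] by (simp add: p_def)
  have "t (n + 1 - p) = n"
    using t'[of "n + 1"] p permutes_not_in[OF \<rho>, of "n + 1"]
    by (simp add: long_cycle_funpow) (simp add: long_cycle_def)
  then have inv: "inv t n = n + 1 - p" using t(1) by (metis permutes_inverses(2))
  then show "inv t n = n + 1 - inv \<rho> 1" by (simp add: p_def)
  let ?N = "m + n - 1"
  have K: "j - 1 + p \<le> ?N + 1" using j p by simp
  show "long_cycle ?N \<circ> subst_perm n 1 \<sigma> \<rho>
       = subst_perm m n t s \<circ> long_cycle ?N ^^ (inv \<sigma> 1 - 1 + inv \<rho> 1)"
  proof
    fix x
    consider "x = 0 \<or> m + n < x" | "1 \<le> x" "x \<le> m + n" by linarith
    then show "(long_cycle ?N \<circ> subst_perm n 1 \<sigma> \<rho>) x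
       = (subst_perm m n t s \<circ> long_cycle ?N ^^ (inv \<sigma> 1 - 1 + inv \<rho> 1)) x"
    proof cases
      case 1
      then have "x \<notin> {1..m + n - 1}" "x \<notin> {1..n + m - 1}" "x \<notin> {1..m + n - 1 + 1}" using n by auto
      then show ?thesis
        using permutes_not_in[OF subst_perm_permutes[OF \<sigma> order_refl m \<rho> n]]
          permutes_not_in[OF subst_perm_permutes[OF t(1) n order_refl s(1) m]]
          permutes_not_in[OF long_cycle_permutes] permutes_not_in[OF long_cycle_funpow_permutes]
        by simp
    next
      case x: 2
      have rot_x: "(long_cycle ?N ^^ (j - 1 + p)) x
          = (if j - 1 + p < x then x - (j - 1 + p) else x + (m + n) - (j - 1 + p))"
        using long_cycle_funpow[OF K, of x] x n by simp
      show ?thesis using j(1) n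
      proof (cases rule: widen_or_block[where p = x])
        case (outside q)
        have q: "1 \<le> q" "q \<le> m + 1" using x outside j n by (auto simp: widen_def split: if_splits)
        have \<sigma>q: "1 \<le> \<sigma> q" "\<sigma> q \<le> m + 1"
          using permutes_interval_image[OF \<sigma>] permutes_not_in[OF \<sigma>, of "m + 1"] q
          by (auto simp: le_Suc_eq)
        moreover have "\<sigma> q \<noteq> 1"
          using outside(2) j inj_eq[OF permutes_inj[OF \<sigma>], of q j] by simp
        ultimately have \<sigma>q: "2 \<le> \<sigma> q" "\<sigma> q \<le> m + 1" by linarith+
        have rot_q: "(long_cycle m ^^ j) q = (if j < q then q - j else q + m + 1 - j)"
          using long_cycle_funpow[of j m q] j q by simp
        have cq: "1 \<le> (long_cycle m ^^ j) q" "(long_cycle m ^^ j) q \<le> m"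
          using q j outside(2) by (auto simp: rot_q)
        have "(long_cycle ?N \<circ> subst_perm n 1 \<sigma> \<rho>) x = long_cycle ?N (widen n 1 (\<sigma> q))"
          using outside subst_perm_widen[OF n, of q \<sigma> 1 \<rho>] by (simp add: j_def)
        also have "\<dots> = n - 1 + long_cycle m (\<sigma> q)"
          using \<sigma>q n by (auto simp: widen_def long_cycle_def)
        also have "\<dots> = subst_perm m n t s (n + 1 - p - 1 + (long_cycle m ^^ j) q)"
          using subst_perm_block[OF t(1) n order_refl cq, of s] inv by (simp add: s')
        also have "n + 1 - p - 1 + (long_cycle m ^^ j) q = (long_cycle ?N ^^ (j - 1 + p)) x"
          proof -
          obtain e where e: "n = p + e" using p(2) by (auto simp: le_iff_add)
          obtain f where f: "m = j + f" using j(2) by (auto simp: le_iff_add)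
          show ?thesis
          proof (cases "j < q")
            case True
            then obtain b where "q = Suc (j + b)" using less_imp_Suc_add by blast
            then show ?thesis
              unfolding rot_x rot_q using outside(1) j(1) p(1) by (simp add: e widen_def)
          next
            case False
            then obtain b where "j = Suc (q + b)" using less_imp_Suc_add[of q j] outside(2) by auto
            then show ?thesis unfolding rot_x rot_q using outside(1) by (simp add: e f widen_def)
          qed
        qed
        finally show ?thesis by (simp add: j_def p_def)
      next
        case (block q)
        have rot_q: "(long_cycle n ^^ p) q = (if p < q then q - p else q + n + 1 - p)"
          using long_cycle_funpow[of p n q] p block by simp
        have cq: "(long_cycle n ^^ p) q \<noteq> n + 1 - p"
          using block p by (auto simp: rot_q)
        have "(long_cycle ?N \<circ> subst_perm n 1 \<sigma> \<rho>) x = long_cycle ?N (\<rho> q)"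
          using block subst_perm_block[OF \<sigma> order_refl m block(2,3), of \<rho>] by (simp add: j_def)
        also have "\<dots> = widen m n (long_cycle n (\<rho> q))"
          using permutes_interval_image[OF \<rho> block(2,3)] m n by (auto simp: widen_def long_cycle_def)
        also have "\<dots> = subst_perm m n t s (widen m (n + 1 - p) ((long_cycle n ^^ p) q))"
          using subst_perm_widen[OF m, of "(long_cycle n ^^ p) q" t n s] inv cq by (simp add: t')
        also have "widen m (n + 1 - p) ((long_cycle n ^^ p) q) = (long_cycle ?N ^^ (j - 1 + p)) x"
          unfolding rot_x using block j(1) p(1,2) m
          by (cases "p < q") (simp_all add: rot_q widen_def ac_simps)
        finally show ?thesis by (simp add: j_def p_def)
      qed
    qed
  qed
qed

section \<open>Linear maps on subspaces\<close>

lemma linear_on_Q_compose: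
  assumes "linear_on_Q V f" "linear_on_Q W g" "\<And>x. x \<in> V \<Longrightarrow> f x \<in> W"
  shows "linear_on_Q V (\<lambda>x. g (f x))"
  using assms by (simp add: linear_on_Q_def)

lemma linear_on_Q_uminus: "linear_on_Q V f \<Longrightarrow> linear_on_Q V (\<lambda>x. - f x)"
  by (simp add: linear_on_Q_def)

lemma linear_on_Q_id: "linear_on_Q V (\<lambda>x. x)"
  by (simp add: linear_on_Q_def)

lemma linear_on_Q_sum:
  assumes "\<And>a. a \<in> A \<Longrightarrow> linear_on_Q V (f a)"
  shows "linear_on_Q V (\<lambda>x. \<Sum>a\<in>A. f a x)"
  using assms by (simp add: linear_on_Q_def sum.distrib rat_vector.scale_sum_right)

lemma linear_on_Q_funpow:
  assumes "linear_on_Q V f" "\<And>x. x \<in> V \<Longrightarrow> f x \<in> V"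
  shows "linear_on_Q V (f ^^ k)"
proof (induction k)
  case (Suc k)
  have "(f ^^ k) x \<in> V" if "x \<in> V" for x
    using that assms(2) by (induction k) auto
  then show ?case
    using linear_on_Q_compose[OF Suc assms(1)] by (simp add: comp_def)
qed (simp add: linear_on_Q_def)

lemma linear_on_Q_0: "\<lbrakk>linear_on_Q V f; 0 \<in> V\<rbrakk> \<Longrightarrow> f 0 = 0"
  by (metis linear_on_Q_def rat_vector.scale_zero_left)

lemma linear_on_Q_subset: "\<lbrakk>linear_on_Q W f; V \<subseteq> W\<rbrakk> \<Longrightarrow> linear_on_Q V f"
  by (simp add: linear_on_Q_def subset_iff)

lemma linear_on_Q_uminus_arg:
  assumes "linear_on_Q V f" "x \<in> V"
  shows "f (- x) = - f x"
proof -
  have "f ((- 1) *\<^sub>Q x) = (- 1) *\<^sub>Q f x"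
    using assms unfolding linear_on_Q_def by blast
  then show ?thesis by simp
qed

lemma linear_on_Q_diff:
  assumes "linear_on_Q V f" "rat_vector.subspace V" "x \<in> V" "y \<in> V"
  shows "f (x - y) = f x - f y"
proof -
  have "- y \<in> V" by (rule rat_vector.subspace_neg[OF assms(2,4)])
  then have "f (x + - y) = f x + f (- y)"
    using assms unfolding linear_on_Q_def by blast
  then show ?thesis by (simp add: linear_on_Q_uminus_arg[OF assms(1,4)])
qed

lemma sum_fun_apply: "(\<Sum>a\<in>A. f a) x = (\<Sum>a\<in>A. f a x)"
  for f :: "'b \<Rightarrow> 'c \<Rightarrow> 'd::comm_monoid_add"
  by (induction A rule: infinite_finite_induct) auto

lemma tens_0 [simp]: "tens 0 \<sigma> = 0"
  by (auto simp: tens_def)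

lemma tens_add: "tens (E + F) \<sigma> = tens E \<sigma> + tens F \<sigma>" for E F :: "'a::rat_vector"
  by (auto simp: tens_def)

lemma tens_uminus: "tens (- E) \<sigma> = - tens E \<sigma>" for E :: "'a::rat_vector"
  by (auto simp: tens_def)

lemma tens_scaleQ: "tens (c *\<^sub>Q E) \<sigma> = c *\<^sub>Q tens E \<sigma>" for E :: "'a::rat_vector"
  by (auto simp: tens_def scaleQ_fun_def)

lemma linear_on_Q_tens: "linear_on_Q V f \<Longrightarrow> linear_on_Q V (\<lambda>x. tens (f x) \<sigma>)"
  for f :: "'a::rat_vector \<Rightarrow> 'b::rat_vector"
  by (simp add: linear_on_Q_def tens_add tens_scaleQ)

lemma sum_single:
  fixes f :: "'b \<Rightarrow> 'c::comm_monoid_add"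
  assumes "finite A" "a \<in> A" "\<And>b. b \<in> A \<Longrightarrow> b \<noteq> a \<Longrightarrow> f b = 0"
  shows "sum f A = f a"
  using assms by (subst sum.remove[of A a]) (auto intro!: sum.neutral)

section \<open>The symmetrization of a non-symmetric operad\<close>

locale symmetrized_operad = ns_operad P for P :: "'a::rat_vector ns_operad_data"
begin

abbreviation "SymP \<equiv> symmetrization P"

lemma sym_components:
  "x \<in> components SymP n \<longleftrightarrow>
     (\<forall>\<pi>. \<pi> permutes {1..n} \<longrightarrow> x \<pi> \<in> components P n) \<and> (\<forall>\<pi>. \<not> \<pi> permutes {1..n} \<longrightarrow> x \<pi> = 0)"
  by (auto simp: symmetrization_def)

lemma zero_closed: "1 \<le> n \<Longrightarrow> 0 \<in> components P n"
  using subspace by (simp add: rat_vector.subspace_0)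

lemma sym_subspace: "1 \<le> n \<Longrightarrow> rat_vector.subspace (components SymP n)"
  using subspace[of n] unfolding rat_vector.subspace_def
  by (simp add: sym_components scaleQ_fun_def)

lemma tens_closed:
  "\<lbrakk>E \<in> components P n; \<sigma> permutes {1..n}; 1 \<le> n\<rbrakk> \<Longrightarrow> tens E \<sigma> \<in> components SymP n"
  using zero_closed by (auto simp: sym_components tens_def)

lemma sym_sum_closed:
  "\<lbrakk>\<And>a. a \<in> A \<Longrightarrow> f a \<in> components SymP n; 1 \<le> n\<rbrakk> \<Longrightarrow> sum f A \<in> components SymP n"
  using sym_subspace by (simp add: rat_vector.subspace_sum)

lemma sym_eq_sum_tens:
  assumes "x \<in> components SymP n"
  shows "x = (\<Sum>\<sigma> | \<sigma> permutes {1..n}. tens (x \<sigma>) \<sigma>)"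
proof
  fix \<pi>
  have "(\<Sum>\<sigma> | \<sigma> permutes {1..n}. tens (x \<sigma>) \<sigma>) \<pi>
      = (\<Sum>\<sigma> | \<sigma> permutes {1..n}. if \<pi> = \<sigma> then x \<sigma> else 0)"
    by (simp add: tens_def sum_fun_apply)
  also have "\<dots> = (if \<pi> permutes {1..n} then x \<pi> else 0)"
    by (subst sum.delta') (simp_all add: finite_permutations)
  finally show "x \<pi> = (\<Sum>\<sigma> | \<sigma> permutes {1..n}. tens (x \<sigma>) \<sigma>) \<pi>"
    using assms by (simp add: sym_components)
qed

text \<open>
  Linear maps are compared on the elements \<open>E \<otimes> \<sigma>\<close>, which span.
\<close>

lemma sym_eqI:
  fixes f g :: "_ \<Rightarrow> 'c::rat_vector"
  assumes "x \<in> components SymP n" "1 \<le> n"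
    and f: "linear_on_Q (components SymP n) f" and g: "linear_on_Q (components SymP n) g"
    and tens: "\<And>E \<sigma>. \<lbrakk>E \<in> components P n; \<sigma> permutes {1..n}\<rbrakk> \<Longrightarrow> f (tens E \<sigma>) = g (tens E \<sigma>)"
  shows "f x = g x"
proof -
  have V: "0 \<in> components SymP n"
    using sym_subspace[OF assms(2)] by (simp add: rat_vector.subspace_0)
  have sum: "h (\<Sum>\<sigma>\<in>A. tens (x \<sigma>) \<sigma>) = (\<Sum>\<sigma>\<in>A. h (tens (x \<sigma>) \<sigma>))"
    if h: "linear_on_Q (components SymP n) h" and "finite A" "A \<subseteq> {\<sigma>. \<sigma> permutes {1..n}}"
    for h :: "_ \<Rightarrow> 'c" and A
    using that(2,3)
  proof (induction A rule: finite_induct)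
    case empty
    then show ?case using linear_on_Q_0[OF h V] by (simp add: zero_fun_def)
  next
    case (insert \<sigma> A)
    have *: "tens (x \<sigma>) \<sigma> \<in> components SymP n" if "\<sigma> permutes {1..n}" for \<sigma>
      using that assms(1,2) by (intro tens_closed) (auto simp: sym_components)
    then have "(\<Sum>\<sigma>\<in>A. tens (x \<sigma>) \<sigma>) \<in> components SymP n"
      using insert assms(2) by (intro sym_sum_closed) auto
    then have "h (tens (x \<sigma>) \<sigma> + (\<Sum>\<sigma>\<in>A. tens (x \<sigma>) \<sigma>))
        = h (tens (x \<sigma>) \<sigma>) + h (\<Sum>\<sigma>\<in>A. tens (x \<sigma>) \<sigma>)"
      using h insert.prems * unfolding linear_on_Q_def by blast
    then show ?case using insert.IH insert.prems by (simp only: sum.insert[OF insert.hyps] insert_subset)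
  qed
  have "f (\<Sum>\<sigma> | \<sigma> permutes {1..n}. tens (x \<sigma>) \<sigma>) = g (\<Sum>\<sigma> | \<sigma> permutes {1..n}. tens (x \<sigma>) \<sigma>)"
    using assms(1) by (simp add: sum f g finite_permutations tens sym_components)
  then show ?thesis using sym_eq_sum_tens[OF assms(1)] by simp
qed

lemma sym_pcomp:
  assumes "1 \<le> i" "i \<le> m" "1 \<le> n"
  shows "pcomp SymP m n i x y =
     (\<Sum>\<sigma> | \<sigma> permutes {1..m}. \<Sum>\<rho> | \<rho> permutes {1..n}.
        tens (pcomp P m n (inv \<sigma> i) (x \<sigma>) (y \<rho>)) (subst_perm n i \<sigma> \<rho>))"
  using assms by (simp add: symmetrization_def block_perm_comp_shift_perm)

lemma sym_perm_act:
  "perm_act SymP n \<pi> x = (\<Sum>\<sigma> | \<sigma> permutes {1..n}. tens (x \<sigma>) (\<pi> \<circ> \<sigma>))"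
  by (simp add: symmetrization_def)

lemma linear_on_Q_sym_eval:
  "\<sigma> permutes {1..n} \<Longrightarrow> linear_on_Q (components P n) f
    \<Longrightarrow> linear_on_Q (components SymP n) (\<lambda>x. f (x \<sigma>))"
  by (simp add: linear_on_Q_def sym_components scaleQ_fun_def)

lemma sym_pcomp_linear_left:
  assumes "y \<in> components SymP n" "1 \<le> i" "i \<le> m" "1 \<le> n"
  shows "linear_on_Q (components SymP m) (\<lambda>x. pcomp SymP m n i x y)"
proof -
  have k: "1 \<le> inv \<sigma> i" "inv \<sigma> i \<le> m" if "\<sigma> \<in> {\<sigma>. \<sigma> permutes {1..m}}" for \<sigma>
    using permutes_inv_interval[of \<sigma> m i] that assms by simp_all
  show ?thesis
    unfolding sym_pcomp[OF assms(2-4)]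
    using assms
    by (intro linear_on_Q_sum linear_on_Q_tens pcomp_linear_left
        linear_on_Q_sym_eval[where f = "\<lambda>E. pcomp P m n _ E _"] k)
      (auto simp: sym_components)
qed

lemma sym_pcomp_linear_right:
  assumes "x \<in> components SymP m" "1 \<le> i" "i \<le> m" "1 \<le> n"
  shows "linear_on_Q (components SymP n) (\<lambda>y. pcomp SymP m n i x y)"
proof -
  have k: "1 \<le> inv \<sigma> i" "inv \<sigma> i \<le> m" if "\<sigma> \<in> {\<sigma>. \<sigma> permutes {1..m}}" for \<sigma>
    using permutes_inv_interval[of \<sigma> m i] that assms by simp_all
  show ?thesis
    unfolding sym_pcomp[OF assms(2-4)]
    using assms
    by (intro linear_on_Q_sum linear_on_Q_tens pcomp_linear_right
        linear_on_Q_sym_eval[where f = "\<lambda>E. pcomp P m n _ _ E"] k)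
      (auto simp: sym_components)
qed

lemma sym_pcomp_closed:
  assumes "x \<in> components SymP m" "y \<in> components SymP n" "1 \<le> i" "i \<le> m" "1 \<le> n"
  shows "pcomp SymP m n i x y \<in> components SymP (m + n - 1)"
proof -
  have k: "1 \<le> inv \<sigma> i" "inv \<sigma> i \<le> m" if "\<sigma> \<in> {\<sigma>. \<sigma> permutes {1..m}}" for \<sigma>
    using permutes_inv_interval[of \<sigma> m i] that assms by simp_all
  show ?thesis
    unfolding sym_pcomp[OF assms(3-5)]
    using assms
    by (intro sym_sum_closed tens_closed pcomp_closed subst_perm_permutes k)
      (auto simp: sym_components)
qed

text \<open>
  The formula from which all axioms are read off, together with \<open>sym_perm_act_tens\<close>.
\<close>

lemma sym_pcomp_tens:
  assumes E: "E \<in> components P m" and F: "F \<in> components P n" and i: "1 \<le> i" "i \<le> m" "1 \<le> n"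
    and \<sigma>: "\<sigma> permutes {1..m}" and \<rho>: "\<rho> permutes {1..n}"
  shows "pcomp SymP m n i (tens E \<sigma>) (tens F \<rho>)
       = tens (pcomp P m n (inv \<sigma> i) E F) (subst_perm n i \<sigma> \<rho>)"
proof -
  have left: "pcomp P m n k 0 G = 0" if "1 \<le> k" "k \<le> m" "G \<in> components P n" for k G
    using linear_on_Q_0[OF pcomp_linear_left[OF that(3,1,2)]] i zero_closed by simp
  have right: "pcomp P m n k E 0 = 0" if "1 \<le> k" "k \<le> m" for k
    using linear_on_Q_0[OF pcomp_linear_right[OF E that]] i zero_closed by simp
  have Fin: "tens F \<rho> \<rho>' \<in> components P n" for \<rho>'
    using F zero_closed[OF i(3)] by (simp add: tens_def)
  have "pcomp SymP m n i (tens E \<sigma>) (tens F \<rho>) = (\<Sum>\<rho>' | \<rho>' permutes {1..n}.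
        tens (pcomp P m n (inv \<sigma> i) (tens E \<sigma> \<sigma>) (tens F \<rho> \<rho>')) (subst_perm n i \<sigma> \<rho>'))"
    unfolding sym_pcomp[OF i]
  proof (rule sum_single)
    fix \<sigma>' assume \<sigma>': "\<sigma>' \<in> {\<sigma>'. \<sigma>' permutes {1..m}}" "\<sigma>' \<noteq> \<sigma>"
    then have "tens E \<sigma> \<sigma>' = 0" by (simp add: tens_def)
    then show "(\<Sum>\<rho>' | \<rho>' permutes {1..n}.
        tens (pcomp P m n (inv \<sigma>' i) (tens E \<sigma> \<sigma>') (tens F \<rho> \<rho>')) (subst_perm n i \<sigma>' \<rho>')) = 0"
      using \<sigma>' i permutes_inv_interval[of \<sigma>' m i] by (simp add: left Fin)
  qed (use \<sigma> in \<open>simp_all add: finite_permutations\<close>)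
  also have "\<dots> = tens (pcomp P m n (inv \<sigma> i) (tens E \<sigma> \<sigma>) (tens F \<rho> \<rho>)) (subst_perm n i \<sigma> \<rho>)"
    using \<rho> permutes_inv_interval[OF \<sigma> i(1,2)]
    by (intro sum_single) (simp_all add: finite_permutations tens_def right zero_fun_def)
  finally show ?thesis by (simp add: tens_def)
qed

lemma sym_perm_act_tens:
  assumes "\<sigma> permutes {1..n}"
  shows "perm_act SymP n \<pi> (tens E \<sigma>) = tens E (\<pi> \<circ> \<sigma>)"
proof -
  have "perm_act SymP n \<pi> (tens E \<sigma>) = tens (tens E \<sigma> \<sigma>) (\<pi> \<circ> \<sigma>)"
    unfolding sym_perm_act using assms
    by (intro sum_single) (auto simp: finite_permutations tens_def)
  then show ?thesis by (simp add: tens_def)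
qed

lemma sym_perm_act_linear: "linear_on_Q (components SymP n) (perm_act SymP n \<pi>)"
  unfolding sym_perm_act
  by (intro linear_on_Q_sum linear_on_Q_tens linear_on_Q_sym_eval[where f = "\<lambda>E. E"])
    (auto simp: linear_on_Q_def)

lemma sym_perm_act_closed:
  "\<lbrakk>x \<in> components SymP n; \<pi> permutes {1..n}; 1 \<le> n\<rbrakk> \<Longrightarrow> perm_act SymP n \<pi> x \<in> components SymP n"
  unfolding sym_perm_act
  by (intro sym_sum_closed tens_closed) (auto simp: sym_components permutes_compose)

lemma sym_linear_pcomp_left:
  assumes "linear_on_Q V u" "\<And>z. z \<in> V \<Longrightarrow> u z \<in> components SymP m"
    and "y \<in> components SymP n" "1 \<le> i" "i \<le> m" "1 \<le> n"
  shows "linear_on_Q V (\<lambda>z. pcomp SymP m n i (u z) y)"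
  by (rule linear_on_Q_compose[OF assms(1) sym_pcomp_linear_left[OF assms(3-6)] assms(2)])

lemma sym_linear_pcomp_right:
  assumes "linear_on_Q V u" "\<And>z. z \<in> V \<Longrightarrow> u z \<in> components SymP n"
    and "x \<in> components SymP m" "1 \<le> i" "i \<le> m" "1 \<le> n"
  shows "linear_on_Q V (\<lambda>z. pcomp SymP m n i x (u z))"
  by (rule linear_on_Q_compose[OF assms(1) sym_pcomp_linear_right[OF assms(3-6)] assms(2)])

lemma sym_linear_perm_act:
  assumes "linear_on_Q V u" "\<And>z. z \<in> V \<Longrightarrow> u z \<in> components SymP n"
  shows "linear_on_Q V (\<lambda>z. perm_act SymP n \<pi> (u z))"
  by (rule linear_on_Q_compose[OF assms(1) sym_perm_act_linear assms(2)])

lemmas sym_linear_intros =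
  linear_on_Q_id sym_linear_pcomp_left sym_linear_pcomp_right sym_linear_perm_act

lemma sym_perm_action:
  assumes n: "1 \<le> n"
  shows "linear_sym_action n (components SymP n) (perm_act SymP n)"
  unfolding linear_sym_action_def
proof (intro conjI allI impI ballI)
  fix x assume x: "x \<in> components SymP n"
  show "perm_act SymP n id x = x"
  proof (rule sym_eqI[OF x n])
    fix E \<sigma> assume "E \<in> components P n" "\<sigma> permutes {1..n}"
    then show "perm_act SymP n id (tens E \<sigma>) = tens E \<sigma>"
      by (simp only: sym_perm_act_tens id_comp)
  qed (rule sym_perm_act_linear linear_on_Q_id)+
  fix \<sigma> \<rho> assume \<sigma>: "\<sigma> permutes {1..n}" and \<rho>: "\<rho> permutes {1..n}"
  show "perm_act SymP n (\<sigma> \<circ> \<rho>) x = perm_act SymP n \<sigma> (perm_act SymP n \<rho> x)"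
  proof (rule sym_eqI[OF x n])
    show "linear_on_Q (components SymP n) (\<lambda>x. perm_act SymP n \<sigma> (perm_act SymP n \<rho> x))"
      by (intro sym_linear_intros sym_perm_act_closed \<rho> n)
    fix E \<pi> assume "E \<in> components P n" "\<pi> permutes {1..n}"
    then show "perm_act SymP n (\<sigma> \<circ> \<rho>) (tens E \<pi>)
        = perm_act SymP n \<sigma> (perm_act SymP n \<rho> (tens E \<pi>))"
      using \<rho> by (simp add: sym_perm_act_tens permutes_compose comp_assoc)
  qed (rule sym_perm_act_linear)
qed (simp_all add: sym_perm_act_linear sym_perm_act_closed n del: One_nat_def)

lemma sym_eqI2:
  fixes f g :: "_ \<Rightarrow> _ \<Rightarrow> 'c::rat_vector"
  assumes x: "x \<in> components SymP m" "1 \<le> m" and y: "y \<in> components SymP n" "1 \<le> n"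
    and "\<And>y. y \<in> components SymP n \<Longrightarrow> linear_on_Q (components SymP m) (\<lambda>x. f x y)"
    and "\<And>y. y \<in> components SymP n \<Longrightarrow> linear_on_Q (components SymP m) (\<lambda>x. g x y)"
    and "\<And>x. x \<in> components SymP m \<Longrightarrow> linear_on_Q (components SymP n) (f x)"
    and "\<And>x. x \<in> components SymP m \<Longrightarrow> linear_on_Q (components SymP n) (g x)"
    and "\<And>E \<sigma> F \<rho>. \<lbrakk>E \<in> components P m; \<sigma> permutes {1..m}; F \<in> components P n; \<rho> permutes {1..n}\<rbrakk>
      \<Longrightarrow> f (tens E \<sigma>) (tens F \<rho>) = g (tens E \<sigma>) (tens F \<rho>)"
  shows "f x y = g x y"
  by (rule sym_eqI[OF x, where f = "\<lambda>x. f x y" and g = "\<lambda>x. g x y"]; (rule sym_eqI[OF y])?)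
    (use assms tens_closed in auto)

lemma sym_assoc_sequential:
  assumes f: "f \<in> components SymP m" and g: "g \<in> components SymP n" and h: "h \<in> components SymP l"
    and i: "1 \<le> i" "i \<le> m" and j: "1 \<le> j" "j \<le> n" and l: "1 \<le> l"
  shows "pcomp SymP (m + n - 1) l (i - 1 + j) (pcomp SymP m n i f g) h
       = pcomp SymP m (n + l - 1) i f (pcomp SymP n l j g h)"
proof (rule sym_eqI[OF h l])
  have bounds: "1 \<le> m" "1 \<le> n" "1 \<le> i - 1 + j" "i - 1 + j \<le> m + n - 1" "1 \<le> n + l - 1"
    using i j l by auto
  show "linear_on_Q (components SymP l)
      (\<lambda>h. pcomp SymP (m + n - 1) l (i - 1 + j) (pcomp SymP m n i f g) h)"
    by (intro sym_linear_intros sym_pcomp_closed f g i j l bounds)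
  show "linear_on_Q (components SymP l) (\<lambda>h. pcomp SymP m (n + l - 1) i f (pcomp SymP n l j g h))"
    by (intro sym_linear_intros sym_pcomp_closed f g i j l bounds)
  fix G \<theta> assume G: "G \<in> components P l" "\<theta> permutes {1..l}"
  note G' = tens_closed[OF G l]
  show "pcomp SymP (m + n - 1) l (i - 1 + j) (pcomp SymP m n i f g) (tens G \<theta>)
      = pcomp SymP m (n + l - 1) i f (pcomp SymP n l j g (tens G \<theta>))"
  proof (rule sym_eqI2[OF f bounds(1) g bounds(2)])
    fix E \<sigma> F \<rho>
    assume E: "E \<in> components P m" "\<sigma> permutes {1..m}" and F: "F \<in> components P n" "\<rho> permutes {1..n}"
    note k = permutes_inv_interval[OF E(2) i] and k' = permutes_inv_interval[OF F(2) j]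
    define q where "q = i - 1 + j"
    have "1 \<le> q" "q \<le> m + n - 1"
      "inv (subst_perm n i \<sigma> \<rho>) q = inv \<sigma> i - 1 + inv \<rho> j"
      "subst_perm l q (subst_perm n i \<sigma> \<rho>) \<theta> = subst_perm (n + l - 1) i \<sigma> (subst_perm l j \<rho> \<theta>)"
      using bounds inv_subst_perm_block[OF E(2) i F(2) j]
        subst_perm_assoc_sequential[OF E(2) i F(2) j G(2) l] by (simp_all only: q_def)
    then show "pcomp SymP (m + n - 1) l (i - 1 + j) (pcomp SymP m n i (tens E \<sigma>) (tens F \<rho>)) (tens G \<theta>)
        = pcomp SymP m (n + l - 1) i (tens E \<sigma>) (pcomp SymP n l j (tens F \<rho>) (tens G \<theta>))"
      using E F G i j l bounds k k' assoc_sequential[OF E(1) F(1) G(1) k(1,2) k'(1,2) l]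
      unfolding q_def[symmetric]
      by (simp add: sym_pcomp_tens pcomp_closed subst_perm_permutes del: One_nat_def)
  qed (intro sym_linear_intros sym_pcomp_closed f g i j l bounds G'; assumption)+
qed

lemma sym_assoc_parallel:
  assumes f: "f \<in> components SymP m" and g: "g \<in> components SymP n" and h: "h \<in> components SymP l"
    and i: "1 \<le> i" "i < j" "j \<le> m" and n: "1 \<le> n" and l: "1 \<le> l"
  shows "pcomp SymP (m + n - 1) l (j - 1 + n) (pcomp SymP m n i f g) h
       = pcomp SymP (m + l - 1) n i (pcomp SymP m l j f h) g"
proof (rule sym_eqI[OF h l])
  have bounds: "1 \<le> m" "1 \<le> j" "i \<le> m" "1 \<le> j - 1 + n" "j - 1 + n \<le> m + n - 1" "i \<le> m + l - 1"
    using i n l by auto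
  have j: "j - 1 + n = widen n i j" "i = widen l j i" "i \<noteq> j" using i by (auto simp: widen_def)
  show "linear_on_Q (components SymP l)
      (\<lambda>h. pcomp SymP (m + n - 1) l (j - 1 + n) (pcomp SymP m n i f g) h)"
    by (intro sym_linear_intros sym_pcomp_closed f g i n l bounds)
  show "linear_on_Q (components SymP l) (\<lambda>h. pcomp SymP (m + l - 1) n i (pcomp SymP m l j f h) g)"
    by (intro sym_linear_intros sym_pcomp_closed f g i n l bounds)
  fix G \<theta> assume G: "G \<in> components P l" "\<theta> permutes {1..l}"
  note G' = tens_closed[OF G l]
  show "pcomp SymP (m + n - 1) l (j - 1 + n) (pcomp SymP m n i f g) (tens G \<theta>)
      = pcomp SymP (m + l - 1) n i (pcomp SymP m l j f (tens G \<theta>)) g"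
  proof (rule sym_eqI2[OF f bounds(1) g n])
    fix E \<sigma> F \<rho>
    assume E: "E \<in> components P m" "\<sigma> permutes {1..m}" and F: "F \<in> components P n" "\<rho> permutes {1..n}"
    define k h where "k = inv \<sigma> i" and "h = inv \<sigma> j"
    have k: "1 \<le> k" "k \<le> m" "\<sigma> k = i" and h: "1 \<le> h" "h \<le> m" "\<sigma> h = j"
      using permutes_inv_interval[OF E(2)] i bounds by (simp_all add: k_def h_def)
    have "h \<noteq> k" using k h i by auto
    have perm: "subst_perm l (j - 1 + n) (subst_perm n i \<sigma> \<rho>) \<theta>
        = subst_perm n i (subst_perm l j \<sigma> \<theta>) \<rho>"
      using subst_perm_assoc_parallel[OF E(2) i(1) bounds(3) bounds(2) i(3) j(3) F(2) n G(2) l] j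
      by simp
    have inv1: "inv (subst_perm n i \<sigma> \<rho>) (j - 1 + n) = widen n k h"
      using inv_subst_perm_widen[OF E(2) i(1) bounds(3) F(2) n, of j] j by (simp add: k_def h_def)
    have inv2: "inv (subst_perm l j \<sigma> \<theta>) i = widen l h k"
      using inv_subst_perm_widen[OF E(2) bounds(2) i(3) G(2) l, of i] j by (simp add: k_def h_def)
    have ns: "pcomp P (m + n - 1) l (widen n k h) (pcomp P m n k E F) G
        = pcomp P (m + l - 1) n (widen l h k) (pcomp P m l h E G) F"
    proof (cases "k < h")
      case True
      then show ?thesis using assoc_parallel[OF E(1) F(1) G(1) k(1) True h(2) n l]
        by (simp add: widen_def)
    next
      case False
      then have "h < k" using \<open>h \<noteq> k\<close> by simp
      then show ?thesis using assoc_parallel[OF E(1) G(1) F(1) h(1) _ k(2) l n]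
        by (simp add: widen_def)
    qed
    define q where "q = j - 1 + n"
    have "1 \<le> q" "q \<le> m + n - 1" "inv (subst_perm n i \<sigma> \<rho>) q = widen n k h"
      "subst_perm l q (subst_perm n i \<sigma> \<rho>) \<theta> = subst_perm n i (subst_perm l j \<sigma> \<theta>) \<rho>"
      using bounds inv1 perm by (simp_all only: q_def)
    then show "pcomp SymP (m + n - 1) l (j - 1 + n) (pcomp SymP m n i (tens E \<sigma>) (tens F \<rho>)) (tens G \<theta>)
        = pcomp SymP (m + l - 1) n i (pcomp SymP m l j (tens E \<sigma>) (tens G \<theta>)) (tens F \<rho>)"
      using E F G i n l bounds k h ns
      unfolding q_def[symmetric]
      by (simp add: sym_pcomp_tens pcomp_closed subst_perm_permutes inv2
          k_def[symmetric] h_def[symmetric] del: One_nat_def)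
  qed (intro sym_linear_intros sym_pcomp_closed f g i n l bounds G'; assumption)+
qed

lemma shift_perm_id: "1 \<le> i \<Longrightarrow> shift_perm n i id = id"
  by (auto simp: shift_perm_def)

lemma block_perm_eq: "\<lbrakk>\<sigma> permutes {1..m}; 1 \<le> i; i \<le> m; 1 \<le> n\<rbrakk> \<Longrightarrow> block_perm m n i \<sigma> = subst_perm n i \<sigma> id"
  using block_perm_comp_shift_perm[of \<sigma> m i id n] permutes_id permutes_inv_interval(1)[of \<sigma> m i]
    shift_perm_id[of "inv \<sigma> i" n] by simp

lemma shift_perm_eq: "\<lbrakk>\<rho> permutes {1..n}; 1 \<le> i; 1 \<le> n\<rbrakk> \<Longrightarrow> shift_perm n i \<rho> = subst_perm n i id \<rho>"
  using block_perm_comp_shift_perm[of id i i \<rho> n] block_perm_eq[of id i i n] permutes_id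
  by (simp add: subst_perm_id)

lemma sym_unit: "op_unit SymP = tens (op_unit P) id"
  by (simp add: symmetrization_def)

lemma sym_unit_closed: "op_unit SymP \<in> components SymP 1"
  using tens_closed[OF unit_closed permutes_id] by (simp add: sym_unit)

lemma sym_unit_left:
  assumes g: "g \<in> components SymP n" "1 \<le> n"
  shows "pcomp SymP 1 n 1 (op_unit SymP) g = g"
proof (rule sym_eqI[OF g])
  fix E \<rho> assume E: "E \<in> components P n" "\<rho> permutes {1..n}"
  have "\<rho> (p + n - 1) = p + n - 1" if "1 < p" for p
    using that g by (intro permutes_not_in[OF E(2)]) auto
  then have "\<rho> = subst_perm n 1 id \<rho>"
    by (intro subst_perm_unique[of id 1])
      (use g permutes_not_in[OF E(2), of 0] in \<open>auto simp: widen_def permutes_id\<close>)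
  then show "pcomp SymP 1 n 1 (op_unit SymP) (tens E \<rho>) = tens E \<rho>"
    using E g by (simp add: sym_unit sym_pcomp_tens unit_closed unit_left permutes_id
        del: One_nat_def)
qed (intro sym_linear_intros sym_unit_closed g order_refl; assumption)+

lemma sym_unit_right:
  assumes f: "f \<in> components SymP m" and i: "1 \<le> i" "i \<le> m"
  shows "pcomp SymP m 1 i f (op_unit SymP) = f"
proof (rule sym_eqI[OF f])
  show m: "1 \<le> m" using i by simp
  fix E \<sigma> assume E: "E \<in> components P m" "\<sigma> permutes {1..m}"
  note k = permutes_inv_interval[OF E(2) i]
  have "\<sigma> = subst_perm 1 i \<sigma> id"
    by (rule subst_perm_unique[OF E(2) i])
      (use i k in \<open>auto simp: widen_def le_Suc_eq\<close>)
  then show "pcomp SymP m 1 i (tens E \<sigma>) (op_unit SymP) = tens E \<sigma>"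
    using E i k by (simp add: sym_unit sym_pcomp_tens unit_closed unit_right permutes_id
        del: One_nat_def)
qed (intro sym_linear_intros sym_unit_closed i order_refl; assumption)+

lemma sym_equivariant_left:
  assumes f: "f \<in> components SymP m" and g: "g \<in> components SymP n"
    and i: "1 \<le> i" "i \<le> m" "1 \<le> n" and \<pi>: "\<pi> permutes {1..m}"
  shows "pcomp SymP m n i (perm_act SymP m \<pi> f) g
       = perm_act SymP (m + n - 1) (block_perm m n i \<pi>) (pcomp SymP m n (inv \<pi> i) f g)"
proof -
  have m: "1 \<le> m" using i by simp
  show ?thesis
  proof (rule sym_eqI2[OF f m g i(3)])
  note k = permutes_inv_interval[OF \<pi> i(1,2)]
  fix E \<sigma> F \<rho>
  assume E: "E \<in> components P m" "\<sigma> permutes {1..m}" and F: "F \<in> components P n" "\<rho> permutes {1..n}"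
  have "inv \<sigma> (inv \<pi> i) = inv (\<pi> \<circ> \<sigma>) i"
    using E(2) \<pi> by (simp add: o_inv_distrib permutes_bij)
  moreover note permutes_inv_interval[OF E(2) k(1,2)]
  ultimately show "pcomp SymP m n i (perm_act SymP m \<pi> (tens E \<sigma>)) (tens F \<rho>)
      = perm_act SymP (m + n - 1) (block_perm m n i \<pi>) (pcomp SymP m n (inv \<pi> i) (tens E \<sigma>) (tens F \<rho>))"
    using E F i k \<pi> m
    by (simp add: sym_pcomp_tens sym_perm_act_tens permutes_compose block_perm_eq
        subst_perm_permutes subst_perm_comp del: One_nat_def)
qed (intro sym_linear_intros sym_pcomp_closed sym_perm_act_closed f g i
      permutes_inv_interval[OF \<pi> i(1,2)] \<pi> m; assumption)+
qed

lemma sym_equivariant_right: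
  assumes f: "f \<in> components SymP m" and g: "g \<in> components SymP n"
    and i: "1 \<le> i" "i \<le> m" "1 \<le> n" and \<pi>: "\<pi> permutes {1..n}"
  shows "pcomp SymP m n i f (perm_act SymP n \<pi> g)
       = perm_act SymP (m + n - 1) (shift_perm n i \<pi>) (pcomp SymP m n i f g)"
proof -
  have m: "1 \<le> m" using i by simp
  show ?thesis
  proof (rule sym_eqI2[OF f m g i(3)])
  fix E \<sigma> F \<rho>
  assume E: "E \<in> components P m" "\<sigma> permutes {1..m}" and F: "F \<in> components P n" "\<rho> permutes {1..n}"
  show "pcomp SymP m n i (tens E \<sigma>) (perm_act SymP n \<pi> (tens F \<rho>))
      = perm_act SymP (m + n - 1) (shift_perm n i \<pi>) (pcomp SymP m n i (tens E \<sigma>) (tens F \<rho>))"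
    using E F i \<pi> m subst_perm_comp[of id m i \<sigma> \<rho> n \<pi>]
    by (simp add: sym_pcomp_tens sym_perm_act_tens permutes_compose shift_perm_eq permutes_id
        subst_perm_permutes del: One_nat_def)
qed (intro sym_linear_intros sym_pcomp_closed sym_perm_act_closed f g i \<pi> m;
      assumption)+
qed

lemma sym_operad: "operad SymP"
  by (unfold_locales)
    (fact sym_subspace sym_unit_closed sym_pcomp_closed sym_pcomp_linear_left
      sym_pcomp_linear_right sym_unit_left sym_unit_right sym_assoc_sequential sym_assoc_parallel
      sym_perm_action sym_equivariant_left sym_equivariant_right)+

end

section \<open>The induced anticyclic structure\<close>

text \<open>
  The letters \<open>j\<close>, \<open>l\<close> and \<open>p\<close> stand below for \<open>\<sigma>\<^sup>-\<^sup>1(1)\<close>, \<open>\<sigma>\<^sup>-\<^sup>1(i)\<close> and \<open>\<rho>\<^sup>-\<^sup>1(1)\<close>: the input of \<open>E\<close> that becomes the root,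
  the input at which \<open>F\<close> is inserted, and the input of \<open>F\<close> that becomes the root.
\<close>

locale symmetrized_anticyclic_operad = symmetrized_operad P + ns_anticyclic_operad P \<tau>
  for P :: "'a::rat_vector ns_operad_data" and \<tau> :: "nat \<Rightarrow> 'a \<Rightarrow> 'a"
begin

abbreviation "act \<equiv> induced_action \<tau>"

lemma tau_funpow_closed: "\<lbrakk>E \<in> components P n; 1 \<le> n\<rbrakk> \<Longrightarrow> (\<tau> n ^^ k) E \<in> components P n"
  by (induction k) (simp_all add: tau_closed)

lemma tau_funpow_linear: "1 \<le> n \<Longrightarrow> linear_on_Q (components P n) (\<tau> n ^^ k)"
  by (rule linear_on_Q_funpow[OF tau_linear tau_closed])

lemma tau_funpow_uminus:
  assumes "E \<in> components P n" "1 \<le> n"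
  shows "(\<tau> n ^^ k) (- E) = - (\<tau> n ^^ k) E"
  by (rule linear_on_Q_uminus_arg[OF tau_funpow_linear[OF assms(2)] assms(1)])

text \<open>
  The root stays among the inputs of \<open>E\<close> to the left of \<open>F\<close>.
\<close>

lemma tau_funpow_pcomp:
  assumes E: "E \<in> components P m" and F: "F \<in> components P n" and n: "1 \<le> n"
    and l: "l \<le> m" and "a < l"
  shows "(\<tau> (m + n - 1) ^^ a) (pcomp P m n l E F) = pcomp P m n (l - a) ((\<tau> m ^^ a) E) F"
  using \<open>a < l\<close>
proof (induction a)
  case (Suc a)
  then have "(\<tau> (m + n - 1) ^^ Suc a) (pcomp P m n l E F)
      = \<tau> (m + n - 1) (pcomp P m n (l - a) ((\<tau> m ^^ a) E) F)"
    by simp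
  also have "\<dots> = pcomp P m n (l - a - 1) (\<tau> m ((\<tau> m ^^ a) E)) F"
    using Suc.prems l E F n by (intro tau_pcomp tau_funpow_closed) auto
  finally show ?case by simp
qed simp

text \<open>
  After \<open>l - 1\<close> rotations \<open>F\<close> sits at the first input of \<open>E\<close>. The next rotation moves the root onto \<open>F\<close>,
  exchanging \<open>E\<close> and \<open>F\<close> with a sign, and the remaining \<open>p - 1\<close> rotations stay within \<open>F\<close>.
\<close>

lemma tau_funpow_pcomp_turn:
  assumes E: "E \<in> components P m" and F: "F \<in> components P n"
    and l: "1 \<le> l" "l \<le> m" and p: "1 \<le> p" "p \<le> n"
  shows "(\<tau> (m + n - 1) ^^ (l - 1 + p)) (pcomp P m n l E F)
       = - pcomp P n m (n + 1 - p) ((\<tau> n ^^ p) F) ((\<tau> m ^^ l) E)"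
proof -
  have m: "1 \<le> m" and n: "1 \<le> n" using l p by auto
  obtain b where b: "p = Suc b" using p by (cases p) auto
  obtain a where a: "l = Suc a" using l by (cases l) auto
  let ?T = "\<tau> (m + n - 1)" and ?E = "(\<tau> m ^^ a) E"
  have E': "?E \<in> components P m" "\<tau> m ?E \<in> components P m" and F': "\<tau> n F \<in> components P n"
    using E F m n by (simp_all add: tau_funpow_closed tau_closed)
  have "(?T ^^ a) (pcomp P m n l E F) = pcomp P m n 1 ?E F"
    using tau_funpow_pcomp[OF E F n l(2), of a] a by simp
  then have "(?T ^^ l) (pcomp P m n l E F) = - pcomp P n m n (\<tau> n F) (\<tau> m ?E)"
    using tau_pcomp_first[OF E'(1) F m n] a by simp
  moreover have "l - 1 + p = b + l" using a b by simp
  ultimately have "(?T ^^ (l - 1 + p)) (pcomp P m n l E F)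
      = (?T ^^ b) (- pcomp P n m n (\<tau> n F) (\<tau> m ?E))"
    by (simp only: funpow_add comp_apply)
  also have "\<dots> = - (?T ^^ b) (pcomp P n m n (\<tau> n F) (\<tau> m ?E))"
    using pcomp_closed[OF F' E'(2) n order_refl m] m n
    by (intro tau_funpow_uminus) (simp_all add: add.commute)
  also have "(?T ^^ b) (pcomp P n m n (\<tau> n F) (\<tau> m ?E))
      = pcomp P n m (n - b) ((\<tau> n ^^ b) (\<tau> n F)) (\<tau> m ?E)"
    using tau_funpow_pcomp[OF F' E'(2) m order_refl, of b] p b by (simp add: add.commute)
  finally show ?thesis by (simp add: a b funpow_swap1)
qed

text \<open>
  If \<open>j > l\<close>, the root travels through all of \<open>F\<close> and returns to \<open>E\<close>. The two exchanges of \<open>E\<close> and \<open>F\<close> cancel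
  their signs, and \<open>F\<close> has been rotated \<open>n + 1\<close> times, hence is unchanged.
\<close>

lemma tau_funpow_pcomp_widen:
  assumes E: "E \<in> components P m" and F: "F \<in> components P n" and n: "1 \<le> n"
    and l: "1 \<le> l" "l \<le> m" and j: "1 \<le> j" "j \<le> m" and "l \<noteq> j"
  shows "(\<tau> (m + n - 1) ^^ widen n l j) (pcomp P m n l E F)
       = pcomp P m n ((long_cycle m ^^ j) l) ((\<tau> m ^^ j) E) F"
proof (cases "j < l")
  case True
  then show ?thesis
    using tau_funpow_pcomp[OF E F n l(2) True] long_cycle_funpow[of j m l] l j
    by (simp add: widen_def)
next
  case False
  then obtain b where b: "j = Suc (l + b)" using less_imp_Suc_add[of l j] \<open>l \<noteq> j\<close> by auto
  let ?T = "\<tau> (m + n - 1)"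
  have m: "1 \<le> m" using l by simp
  have E': "(\<tau> m ^^ l) E \<in> components P m" "\<tau> m ((\<tau> m ^^ l) E) \<in> components P m"
    and F': "(\<tau> n ^^ n) F \<in> components P n"
    using E F m n by (simp_all add: tau_funpow_closed tau_closed)
  have "(?T ^^ (l - 1 + n)) (pcomp P m n l E F) = - pcomp P n m 1 ((\<tau> n ^^ n) F) ((\<tau> m ^^ l) E)"
    using tau_funpow_pcomp_turn[OF E F l n order_refl] by simp
  then have "?T ((?T ^^ (l - 1 + n)) (pcomp P m n l E F))
      = - ?T (pcomp P n m 1 ((\<tau> n ^^ n) F) ((\<tau> m ^^ l) E))"
    using pcomp_closed[OF F' E'(1) order_refl n m] m n tau_funpow_uminus[of _ "m + n - 1" 1]
    by (simp add: add.commute)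
  also have "\<dots> = pcomp P m n m (\<tau> m ((\<tau> m ^^ l) E)) (\<tau> n ((\<tau> n ^^ n) F))"
    using tau_pcomp_first[OF F' E'(1) n m] by (simp add: add.commute)
  also have "\<tau> n ((\<tau> n ^^ n) F) = F"
    using tau_order[OF F n] by simp
  \<comment> \<open>The root has just returned to \<open>E\<close>, so that \<open>F\<close> sits at its last input.\<close>
  finally have turn: "(?T ^^ (l + n)) (pcomp P m n l E F) = pcomp P m n m (\<tau> m ((\<tau> m ^^ l) E)) F"
    using l by (cases l) simp_all
  have "widen n l j = b + (l + n)" using b n by (simp add: widen_def)
  then have "(?T ^^ widen n l j) (pcomp P m n l E F)
      = (?T ^^ b) (pcomp P m n m (\<tau> m ((\<tau> m ^^ l) E)) F)"
    using turn by (simp only: funpow_add comp_apply)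
  also have "\<dots> = pcomp P m n (m - b) ((\<tau> m ^^ b) (\<tau> m ((\<tau> m ^^ l) E))) F"
    using b j l by (intro tau_funpow_pcomp E' F n) auto
  also have "(\<tau> m ^^ b) (\<tau> m ((\<tau> m ^^ l) E)) = (\<tau> m ^^ j) E"
  proof -
    have "j = b + Suc l" using b by simp
    then show ?thesis by (simp only: funpow_add comp_apply funpow.simps)
  qed
  also have "m - b = (long_cycle m ^^ j) l"
    using long_cycle_funpow[of j m l] l j b by simp
  finally show ?thesis .
qed

text \<open>
  Allowing an arbitrary exponent \<open>k\<close>, not only \<open>k \<le> n\<close>, makes the exponents additive under composition
  of permutations. This is legitimate because \<open>c\<close> and \<open>\<tau>\<^sub>n\<close> both have order dividing \<open>n + 1\<close>.
\<close>

lemma act_tens: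
  assumes E: "E \<in> components P n" and n: "1 \<le> n"
    and \<sigma>: "\<sigma> permutes {1..n}" and s: "s permutes {1..n}" and eq: "\<pi> \<circ> \<sigma> = s \<circ> long_cycle n ^^ k"
  shows "act n \<pi> (tens E \<sigma>) = tens ((\<tau> n ^^ k) E) s"
proof -
  \<comment> \<open>Only exponents up to \<open>n\<close> occur in the sum defining the action, and there they are unique.\<close>
  define k' where "k' = k mod (n + 1)"
  have k': "k' \<le> n" by (simp add: k'_def less_Suc_eq_le[symmetric])
  have c: "long_cycle n ^^ k = long_cycle n ^^ k'"
    unfolding k'_def
    by (rule ext, rule funpow_mod_eq[symmetric]) (simp only: long_cycle_order id_apply)
  have \<tau>: "(\<tau> n ^^ k) E = (\<tau> n ^^ k') E"
    unfolding k'_def by (rule funpow_mod_eq[symmetric]) (rule tau_order[OF E n])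
  have fin: "finite {\<sigma>. \<sigma> permutes {1..n}}" by (simp add: finite_permutations)
  have zero: "(\<tau> n ^^ l) 0 = 0" for l
    using linear_on_Q_0[OF tau_funpow_linear[OF n] zero_closed[OF n]] .
  define f where "f \<sigma>' s' l =
     (if \<pi> \<circ> \<sigma>' = s' \<circ> (long_cycle n ^^ l) then tens ((\<tau> n ^^ l) (tens E \<sigma> \<sigma>')) s' else 0)" for \<sigma>' s' l
  have vanish: "f \<sigma>' s' l = 0" if "\<sigma>' \<noteq> \<sigma>" for \<sigma>' s' l
    using that by (simp add: f_def tens_def[of E] zero)
  have "act n \<pi> (tens E \<sigma>) = (\<Sum>\<sigma>' | \<sigma>' permutes {1..n}. \<Sum>s' | s' permutes {1..n}. \<Sum>l\<in>{0..n}. f \<sigma>' s' l)"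
    by (simp only: induced_action_def f_def)
  also have "\<dots> = (\<Sum>s' | s' permutes {1..n}. \<Sum>l\<in>{0..n}. f \<sigma> s' l)"
    using \<sigma> by (intro sum_single fin) (simp_all add: vanish)
  also have "\<dots> = (\<Sum>l\<in>{0..n}. f \<sigma> s l)"
  proof (intro sum_single fin sum.neutral ballI)
    fix s' l assume s': "s' \<in> {s. s permutes {1..n}}" "s' \<noteq> s" and l: "l \<in> {0..n}"
    have "\<pi> \<circ> \<sigma> \<noteq> s' \<circ> long_cycle n ^^ l"
      using permutes_decomposition_unique(1)[OF s _ k', of s' l] s' l eq c by auto
    then show "f \<sigma> s' l = 0" by (simp add: f_def)
  qed (use s in simp)
  also have "\<dots> = f \<sigma> s k'"
  proof (intro sum_single)
    fix l assume l: "l \<in> {0..n}" "l \<noteq> k'"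
    have "\<pi> \<circ> \<sigma> \<noteq> s \<circ> long_cycle n ^^ l"
      using permutes_decomposition_unique(2)[OF s s k', of l] l eq c by auto
    then show "f \<sigma> s l = 0" by (simp add: f_def)
  qed (use k' in simp_all)
  also have "\<dots> = tens ((\<tau> n ^^ k) E) s"
    using eq by (simp add: f_def c \<tau> tens_def)
  finally show ?thesis .
qed

lemma act_linear:
  assumes "1 \<le> n"
  shows "linear_on_Q (components SymP n) (act n \<pi>)"
proof -
  have "linear_on_Q (components SymP n)
      (\<lambda>x. if \<pi> \<circ> \<sigma> = s \<circ> (long_cycle n ^^ k) then tens ((\<tau> n ^^ k) (x \<sigma>)) s else 0)"
    if "\<sigma> permutes {1..n}" for \<sigma> s k
    using linear_on_Q_tens[OF linear_on_Q_sym_eval[OF that tau_funpow_linear[OF assms]]]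
    by (cases "\<pi> \<circ> \<sigma> = s \<circ> (long_cycle n ^^ k)") (simp_all add: linear_on_Q_def)
  then show ?thesis
    unfolding induced_action_def by (intro linear_on_Q_sum) simp
qed

lemma act_closed:
  assumes x: "x \<in> components SymP n" and n: "1 \<le> n"
  shows "act n \<pi> x \<in> components SymP n"
  unfolding induced_action_def
proof (intro sym_sum_closed n)
  fix \<sigma> s k assume "\<sigma> \<in> {\<sigma>. \<sigma> permutes {1..n}}" "s \<in> {s. s permutes {1..n}}"
  then have "tens ((\<tau> n ^^ k) (x \<sigma>)) s \<in> components SymP n"
    using x n by (intro tens_closed tau_funpow_closed) (auto simp: sym_components)
  then show "(if \<pi> \<circ> \<sigma> = s \<circ> (long_cycle n ^^ k) then tens ((\<tau> n ^^ k) (x \<sigma>)) s else 0)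
      \<in> components SymP n"
    using sym_subspace[OF n] by (simp add: rat_vector.subspace_0)
qed

lemma sym_linear_act:
  assumes "linear_on_Q V u" "\<And>z. z \<in> V \<Longrightarrow> u z \<in> components SymP n" "1 \<le> n"
  shows "linear_on_Q V (\<lambda>z. act n \<pi> (u z))"
  by (rule linear_on_Q_compose[OF assms(1) act_linear[OF assms(3)] assms(2)])

lemma act_perm:
  assumes x: "x \<in> components SymP n" and n: "1 \<le> n" and \<pi>: "\<pi> permutes {1..n}"
  shows "act n \<pi> x = perm_act SymP n \<pi> x"
proof (rule sym_eqI[OF x n act_linear[OF n] sym_perm_act_linear])
  fix E \<sigma> assume E: "E \<in> components P n" and \<sigma>: "\<sigma> permutes {1..n}"
  show "act n \<pi> (tens E \<sigma>) = perm_act SymP n \<pi> (tens E \<sigma>)"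
    using act_tens[OF E n \<sigma> permutes_compose[OF \<sigma> \<pi>], where k = 0] sym_perm_act_tens[OF \<sigma>] by simp
qed

lemma act_action:
  assumes n: "1 \<le> n"
  shows "linear_sym_action (n + 1) (components SymP n) (act n)"
  unfolding linear_sym_action_def
proof (intro conjI allI impI ballI)
  fix x assume x: "x \<in> components SymP n"
  show "act n id x = x"
    using act_perm[OF x n permutes_id] sym_perm_action[OF n] x by (simp add: linear_sym_action_def)
  fix \<pi> \<rho> assume \<pi>: "\<pi> permutes {1..n + 1}" and \<rho>: "\<rho> permutes {1..n + 1}"
  show "act n (\<pi> \<circ> \<rho>) x = act n \<pi> (act n \<rho> x)"
  proof (rule sym_eqI[OF x n])
    show "linear_on_Q (components SymP n) (\<lambda>x. act n \<pi> (act n \<rho> x))"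
      by (intro sym_linear_act act_linear act_closed n)
    fix E \<sigma> assume E: "E \<in> components P n" and \<sigma>: "\<sigma> permutes {1..n}"
    have \<sigma>': "\<sigma> permutes {1..n + 1}" using \<sigma> by (rule permutes_subset) auto
    obtain s k where s: "s permutes {1..n}" "\<rho> \<circ> \<sigma> = s \<circ> long_cycle n ^^ k"
      using permutes_decomposition[OF permutes_compose[OF \<sigma>' \<rho>]] by metis
    have s': "s permutes {1..n + 1}" using s(1) by (rule permutes_subset) auto
    obtain t l where t: "t permutes {1..n}" "\<pi> \<circ> s = t \<circ> long_cycle n ^^ l"
      using permutes_decomposition[OF permutes_compose[OF s' \<pi>]] by metis
    have "(\<pi> \<circ> \<rho>) \<circ> \<sigma> = t \<circ> long_cycle n ^^ (l + k)"
      using s(2) t(2) by (metis comp_assoc funpow_add)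
    then have "act n (\<pi> \<circ> \<rho>) (tens E \<sigma>) = tens ((\<tau> n ^^ (l + k)) E) t"
      by (rule act_tens[OF E n \<sigma> t(1)])
    also have "\<dots> = act n \<pi> (tens ((\<tau> n ^^ k) E) s)"
      using act_tens[OF tau_funpow_closed[OF E n] n s(1) t] by (simp add: funpow_add)
    also have "tens ((\<tau> n ^^ k) E) s = act n \<rho> (tens E \<sigma>)"
      using act_tens[OF E n \<sigma> s] by simp
    finally show "act n (\<pi> \<circ> \<rho>) (tens E \<sigma>) = act n \<pi> (act n \<rho> (tens E \<sigma>))" .
  qed (rule act_linear[OF n])
qed (simp_all add: act_linear act_closed n del: One_nat_def)

lemma act_long_cycle_tens:
  assumes E: "E \<in> components P n" and n: "1 \<le> n" and \<sigma>: "\<sigma> permutes {1..n}"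
  obtains s where "s permutes {1..n}" "long_cycle n \<circ> \<sigma> = s \<circ> long_cycle n ^^ inv \<sigma> 1"
    "act n (long_cycle n) (tens E \<sigma>) = tens ((\<tau> n ^^ inv \<sigma> 1) E) s"
proof -
  have \<sigma>': "\<sigma> permutes {1..n + 1}" using \<sigma> by (rule permutes_subset) auto
  have c: "long_cycle n \<circ> \<sigma> permutes {1..n + 1}"
    by (rule permutes_compose[OF \<sigma>' long_cycle_permutes])
  have "(long_cycle n \<circ> \<sigma>) (inv \<sigma> 1) = n + 1"
    using \<sigma> by (simp add: permutes_inverses long_cycle_def)
  then have inv: "inv (long_cycle n \<circ> \<sigma>) (n + 1) = inv \<sigma> 1"
    using c by (simp add: permutes_inv_eq)
  obtain s where "s permutes {1..n}" "long_cycle n \<circ> \<sigma> = s \<circ> long_cycle n ^^ inv \<sigma> 1"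
    using permutes_decomposition[OF c] unfolding inv by metis
  then show ?thesis using that act_tens[OF E n \<sigma>] by simp
qed

lemma act_unit: "act 1 (long_cycle 1) (op_unit SymP) = - op_unit SymP"
proof -
  have "act 1 (long_cycle 1) (tens (op_unit P) id) = tens ((\<tau> 1 ^^ 1) (op_unit P)) id"
    by (rule act_tens[OF unit_closed order_refl permutes_id permutes_id]) simp
  then show ?thesis by (simp add: sym_unit tau_unit[simplified] tens_uminus)
qed

lemma act_pcomp:
  assumes f: "f \<in> components SymP m" and g: "g \<in> components SymP n" and i: "2 \<le> i" "i \<le> m" and n: "1 \<le> n"
  shows "act (m + n - 1) (long_cycle (m + n - 1)) (pcomp SymP m n i f g)
       = pcomp SymP m n (i - 1) (act m (long_cycle m) f) g"
proof -
  have bounds: "1 \<le> m" "1 \<le> i" "1 \<le> m + n - 1" "1 \<le> i - 1" "i - 1 \<le> m" using i n by auto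
  show ?thesis
  proof (rule sym_eqI2[OF f bounds(1) g n])
    fix E \<sigma> F \<rho>
    assume E: "E \<in> components P m" and \<sigma>: "\<sigma> permutes {1..m}"
      and F: "F \<in> components P n" and \<rho>: "\<rho> permutes {1..n}"
    note l = permutes_inv_interval[OF \<sigma> bounds(2) i(2)]
    note j = permutes_inv_interval[OF \<sigma> order_refl bounds(1)]
    have "inv \<sigma> i \<noteq> inv \<sigma> 1" using l j i by auto
    obtain s where s: "s permutes {1..m}" "long_cycle m \<circ> \<sigma> = s \<circ> long_cycle m ^^ inv \<sigma> 1"
      and act_s: "act m (long_cycle m) (tens E \<sigma>) = tens ((\<tau> m ^^ inv \<sigma> 1) E) s"
      using act_long_cycle_tens[OF E bounds(1) \<sigma>] .
    note perm = long_cycle_comp_subst_perm[OF \<sigma> i \<rho> n s]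
    have "act (m + n - 1) (long_cycle (m + n - 1)) (pcomp SymP m n i (tens E \<sigma>) (tens F \<rho>))
        = tens ((\<tau> (m + n - 1) ^^ widen n (inv \<sigma> i) (inv \<sigma> 1)) (pcomp P m n (inv \<sigma> i) E F))
            (subst_perm n (i - 1) s \<rho>)"
      unfolding sym_pcomp_tens[OF E F bounds(2) i(2) n \<sigma> \<rho>]
      by (rule act_tens[OF pcomp_closed[OF E F l(1,2) n] bounds(3)
            subst_perm_permutes[OF \<sigma> bounds(2) i(2) \<rho> n]
            subst_perm_permutes[OF s(1) bounds(4,5) \<rho> n] perm(2)])
    also have "\<dots> = pcomp SymP m n (i - 1) (tens ((\<tau> m ^^ inv \<sigma> 1) E) s) (tens F \<rho>)"
      unfolding sym_pcomp_tens[OF tau_funpow_closed[OF E bounds(1)] F bounds(4,5) n s(1) \<rho>] perm(1)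
      by (simp only: tau_funpow_pcomp_widen[OF E F n l(1,2) j(1,2) \<open>inv \<sigma> i \<noteq> inv \<sigma> 1\<close>])
    finally show "act (m + n - 1) (long_cycle (m + n - 1)) (pcomp SymP m n i (tens E \<sigma>) (tens F \<rho>))
        = pcomp SymP m n (i - 1) (act m (long_cycle m) (tens E \<sigma>)) (tens F \<rho>)"
      by (simp only: act_s)
  qed (intro sym_linear_intros sym_linear_act sym_pcomp_closed act_closed act_linear f g i n bounds;
      assumption)+
qed

lemma act_pcomp_first:
  assumes f: "f \<in> components SymP m" and g: "g \<in> components SymP n" and m: "1 \<le> m" and n: "1 \<le> n"
  shows "act (m + n - 1) (long_cycle (m + n - 1)) (pcomp SymP m n 1 f g)
       = - pcomp SymP n m n (act n (long_cycle n) g) (act m (long_cycle m) f)"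
proof -
  have bounds: "1 \<le> m + n - 1" using m n by auto
  show ?thesis
  proof (rule sym_eqI2[OF f m g n])
    fix E \<sigma> F \<rho>
    assume E: "E \<in> components P m" and \<sigma>: "\<sigma> permutes {1..m}"
      and F: "F \<in> components P n" and \<rho>: "\<rho> permutes {1..n}"
    note j = permutes_inv_interval[OF \<sigma> order_refl m]
    note p = permutes_inv_interval[OF \<rho> order_refl n]
    obtain s where s: "s permutes {1..m}" "long_cycle m \<circ> \<sigma> = s \<circ> long_cycle m ^^ inv \<sigma> 1"
      and act_s: "act m (long_cycle m) (tens E \<sigma>) = tens ((\<tau> m ^^ inv \<sigma> 1) E) s"
      using act_long_cycle_tens[OF E m \<sigma>] .
    obtain t where t: "t permutes {1..n}" "long_cycle n \<circ> \<rho> = t \<circ> long_cycle n ^^ inv \<rho> 1"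
      and act_t: "act n (long_cycle n) (tens F \<rho>) = tens ((\<tau> n ^^ inv \<rho> 1) F) t"
      using act_long_cycle_tens[OF F n \<rho>] .
    note perm = long_cycle_comp_subst_perm_first[OF \<sigma> m \<rho> n s t]
    have comm: "n + m - 1 = m + n - 1" by simp
    have "act (m + n - 1) (long_cycle (m + n - 1)) (pcomp SymP m n 1 (tens E \<sigma>) (tens F \<rho>))
        = tens ((\<tau> (m + n - 1) ^^ (inv \<sigma> 1 - 1 + inv \<rho> 1)) (pcomp P m n (inv \<sigma> 1) E F))
            (subst_perm m n t s)"
      unfolding sym_pcomp_tens[OF E F order_refl m n \<sigma> \<rho>]
      by (rule act_tens[OF pcomp_closed[OF E F j(1,2) n] bounds
            subst_perm_permutes[OF \<sigma> order_refl m \<rho> n]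
            subst_perm_permutes[OF t(1) n order_refl s(1) m, unfolded comm] perm(2)])
    also have "\<dots> = - pcomp SymP n m n (tens ((\<tau> n ^^ inv \<rho> 1) F) t) (tens ((\<tau> m ^^ inv \<sigma> 1) E) s)"
      unfolding sym_pcomp_tens[OF tau_funpow_closed[OF F n] tau_funpow_closed[OF E m] n order_refl m t(1) s(1)]
        perm(1) tau_funpow_pcomp_turn[OF E F j(1,2) p(1,2)]
      by (simp only: tens_uminus)
    finally show "act (m + n - 1) (long_cycle (m + n - 1)) (pcomp SymP m n 1 (tens E \<sigma>) (tens F \<rho>))
        = - pcomp SymP n m n (act n (long_cycle n) (tens F \<rho>)) (act m (long_cycle m) (tens E \<sigma>))"
      by (simp only: act_s act_t)
  qed (intro linear_on_Q_uminus sym_linear_intros sym_linear_act sym_pcomp_closed act_closed act_linear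
      f g m n bounds order_refl; assumption)+
qed

lemma sym_anticyclic_operad: "anticyclic_operad SymP act"
  by (intro anticyclic_operad.intro anticyclic_operad_axioms.intro sym_operad)
    (fact act_action act_perm act_unit act_pcomp act_pcomp_first)+

end

section \<open>Suboperads of anticyclic operads\<close>

lemma linear_sym_action_subset:
  assumes "linear_sym_action N W a" "V \<subseteq> W"
    and "\<And>\<sigma> x. \<lbrakk>\<sigma> permutes {1..N}; x \<in> V\<rbrakk> \<Longrightarrow> a \<sigma> x \<in> V"
  shows "linear_sym_action N V a"
  using assms linear_on_Q_subset[OF _ assms(2)] unfolding linear_sym_action_def by blast

lemma suboperad_perm_act:
  "\<lbrakk>suboperad P S; 1 \<le> n; \<sigma> permutes {1..n}; x \<in> S n\<rbrakk> \<Longrightarrow> perm_act P n \<sigma> x \<in> S n"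
  by (simp add: suboperad_def)

lemma restriction_simps:
  fixes P :: "('a::rat_vector, 'b) operad_data_scheme"
  shows "components (P\<lparr>components := S\<rparr>) = S" "op_unit (P\<lparr>components := S\<rparr>) = op_unit P"
    "pcomp (P\<lparr>components := S\<rparr>) = pcomp P" "perm_act (P\<lparr>components := S\<rparr>) = perm_act P"
  by simp_all

lemma suboperad_operad:
  assumes "operad P" and S: "suboperad P S"
  shows "operad (P\<lparr>components := S\<rparr>)"
proof -
  interpret operad P by fact
  have sub: "S n \<subseteq> components P n" if "1 \<le> n" for n
    using S that by (simp add: suboperad_def)
  then have mem: "x \<in> components P n" if "x \<in> S n" "1 \<le> n" for x n using that by blast
  have dom: "1 \<le> m" if "1 \<le> i" "i \<le> m" for i m :: nat using that by simp
  show ?thesis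
  proof (unfold_locales; (simp only: restriction_simps)?)
    show "rat_vector.subspace (S n)" if "1 \<le> n" for n
      using S that by (simp add: suboperad_def)
    show "op_unit P \<in> S 1" using S by (simp add: suboperad_def)
    show "pcomp P m n i f g \<in> S (m + n - 1)"
      if "f \<in> S m" "g \<in> S n" "1 \<le> i" "i \<le> m" "1 \<le> n" for f g m n i
      using S that by (simp add: suboperad_def)
    show "linear_on_Q (S m) (\<lambda>f. pcomp P m n i f g)"
      if "g \<in> S n" "1 \<le> i" "i \<le> m" "1 \<le> n" for g m n i
      using that mem sub dom by (intro linear_on_Q_subset[OF pcomp_linear_left]) auto
    show "linear_on_Q (S n) (\<lambda>g. pcomp P m n i f g)"
      if "f \<in> S m" "1 \<le> i" "i \<le> m" "1 \<le> n" for f m n i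
      using that mem[OF that(1)] sub dom by (intro linear_on_Q_subset[OF pcomp_linear_right]) auto
    show "pcomp P 1 n 1 (op_unit P) g = g" if "g \<in> S n" "1 \<le> n" for g n
      using that mem by (intro unit_left)
    show "pcomp P m 1 i f (op_unit P) = f" if "f \<in> S m" "1 \<le> i" "i \<le> m" for f m i
      using that mem dom by (intro unit_right) auto
    show "pcomp P (m + n - 1) l (i - 1 + j) (pcomp P m n i f g) h
        = pcomp P m (n + l - 1) i f (pcomp P n l j g h)"
      if "f \<in> S m" "g \<in> S n" "h \<in> S l" "1 \<le> i" "i \<le> m" "1 \<le> j" "j \<le> n" "1 \<le> l"
      for f g h i j m n l
      using that mem dom by (intro assoc_sequential) auto
    show "pcomp P (m + n - 1) l (k - 1 + n) (pcomp P m n i f g) h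
        = pcomp P (m + l - 1) n i (pcomp P m l k f h) g"
      if "f \<in> S m" "g \<in> S n" "h \<in> S l" "1 \<le> i" "i < k" "k \<le> m" "1 \<le> n" "1 \<le> l"
      for f g h i k m n l
      using that mem by (intro assoc_parallel) auto
    show "linear_sym_action n (S n) (perm_act P n)" if "1 \<le> n" for n
      using S that sub[OF that]
      by (intro linear_sym_action_subset[OF perm_action]) (auto simp: suboperad_def)
    show "pcomp P m n i (perm_act P m \<sigma> f) g
        = perm_act P (m + n - 1) (block_perm m n i \<sigma>) (pcomp P m n (inv \<sigma> i) f g)"
      if "f \<in> S m" "g \<in> S n" "1 \<le> i" "i \<le> m" "1 \<le> n" "\<sigma> permutes {1..m}" for f g m n i \<sigma>
      using that mem dom by (intro equivariant_left) auto
    show "pcomp P m n i f (perm_act P n \<rho> g)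
        = perm_act P (m + n - 1) (shift_perm n i \<rho>) (pcomp P m n i f g)"
      if "f \<in> S m" "g \<in> S n" "1 \<le> i" "i \<le> m" "1 \<le> n" "\<rho> permutes {1..n}" for f g m n i \<rho>
      using that mem dom by (intro equivariant_right) auto
  qed
qed

lemma suboperad_anticyclic:
  assumes "anticyclic_operad P \<alpha>" and S: "suboperad P S"
    and stable: "\<And>n \<pi> x. \<lbrakk>1 \<le> n; \<pi> permutes {1..n + 1}; x \<in> S n\<rbrakk> \<Longrightarrow> \<alpha> n \<pi> x \<in> S n"
  shows "anticyclic_operad (P\<lparr>components := S\<rparr>) \<alpha>"
    and "anticyclic_morphism (P\<lparr>components := S\<rparr>) \<alpha> P \<alpha> (\<lambda>n x. x)"
proof -
  interpret anticyclic_operad P \<alpha> by fact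
  have sub: "S n \<subseteq> components P n" if "1 \<le> n" for n
    using S that by (simp add: suboperad_def)
  then have mem: "x \<in> components P n" if "x \<in> S n" "1 \<le> n" for x n using that by blast
  have sub_operad: "operad (P\<lparr>components := S\<rparr>)" by (rule suboperad_operad[OF operad_axioms S])
  show sub_anticyclic: "anticyclic_operad (P\<lparr>components := S\<rparr>) \<alpha>"
  proof (intro anticyclic_operad.intro[OF sub_operad] anticyclic_operad_axioms.intro;
      (simp only: restriction_simps)?)
    show "linear_sym_action (n + 1) (S n) (\<alpha> n)" if "1 \<le> n" for n
      by (rule linear_sym_action_subset[OF cyc_action[OF that] sub[OF that] stable[OF that]])
    show "\<alpha> n \<sigma> f = perm_act P n \<sigma> f" if "f \<in> S n" "1 \<le> n" "\<sigma> permutes {1..n}" for f n \<sigma>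
      using that mem by (intro cyc_extends)
    show "\<alpha> 1 (long_cycle 1) (op_unit P) = - op_unit P" by (rule cyc_unit)
    show "\<alpha> (m + n - 1) (long_cycle (m + n - 1)) (pcomp P m n i f g)
        = pcomp P m n (i - 1) (\<alpha> m (long_cycle m) f) g"
      if "f \<in> S m" "g \<in> S n" "2 \<le> i" "i \<le> m" "1 \<le> n" for f g i m n
      using that mem by (intro cyc_pcomp) auto
    show "\<alpha> (m + n - 1) (long_cycle (m + n - 1)) (pcomp P m n 1 f g)
        = - pcomp P n m n (\<alpha> n (long_cycle n) g) (\<alpha> m (long_cycle m) f)"
      if "f \<in> S m" "g \<in> S n" "1 \<le> m" "1 \<le> n" for f g m n
      using that mem by (intro cyc_pcomp_first) auto
  qed
  show "anticyclic_morphism (P\<lparr>components := S\<rparr>) \<alpha> P \<alpha> (\<lambda>n x. x)"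
    by (intro anticyclic_morphism.intro operad_morphism.intro sub_anticyclic sub_operad
        anticyclic_operad_axioms operad_axioms operad_morphism_axioms.intro
        anticyclic_morphism_axioms.intro linear_on_Q_id)
      (simp_all add: mem)
qed

lemma generated_suboperad_mem:
  "x \<in> components (generated_suboperad P X) n \<longleftrightarrow>
     (\<forall>S. suboperad P S \<longrightarrow> (\<forall>k\<ge>1. X k \<subseteq> S k) \<longrightarrow> x \<in> S n)"
  by (auto simp: generated_suboperad_def)

lemma (in operad) suboperad_self: "suboperad P (components P)"
  using subspace unit_closed pcomp_closed perm_action
  by (auto simp: suboperad_def linear_sym_action_def)

text \<open>
  Suboperads are closed under intersection, and \<open>P\<close> itself is one of those that are intersected.
\<close>

lemma suboperad_generated:
  assumes "operad P" and X: "\<And>k. 1 \<le> k \<Longrightarrow> X k \<subseteq> components P k"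
  shows "suboperad P (components (generated_suboperad P X))"
  unfolding suboperad_def rat_vector.subspace_def
proof (intro conjI allI impI ballI)
  show "components (generated_suboperad P X) n \<subseteq> components P n" if "1 \<le> n" for n
    using operad.suboperad_self[OF assms(1)] X by (auto simp: generated_suboperad_mem)
qed (auto simp: generated_suboperad_mem suboperad_def rat_vector.subspace_def)

lemma generators_subset: "1 \<le> k \<Longrightarrow> X k \<subseteq> components (generated_suboperad P X) k"
  by (simp only: subset_iff generated_suboperad_mem) blast

context anticyclic_operad
begin

lemma cyc_linear: "\<lbrakk>1 \<le> n; \<pi> permutes {1..n + 1}\<rbrakk> \<Longrightarrow> linear_on_Q (components P n) (\<alpha> n \<pi>)"
  using cyc_action[of n] by (simp add: linear_sym_action_def)

lemma cyc_closed:
  "\<lbrakk>x \<in> components P n; 1 \<le> n; \<pi> permutes {1..n + 1}\<rbrakk> \<Longrightarrow> \<alpha> n \<pi> x \<in> components P n"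
  using cyc_action[of n] by (simp add: linear_sym_action_def)

lemma cyc_comp:
  "\<lbrakk>x \<in> components P n; 1 \<le> n; \<pi> permutes {1..n + 1}; \<rho> permutes {1..n + 1}\<rbrakk>
    \<Longrightarrow> \<alpha> n (\<pi> \<circ> \<rho>) x = \<alpha> n \<pi> (\<alpha> n \<rho> x)"
  using cyc_action[of n] by (simp add: linear_sym_action_def)

lemma cyc_uminus:
  assumes "x \<in> components P n" "1 \<le> n" "\<pi> permutes {1..n + 1}"
  shows "\<alpha> n \<pi> (- x) = - \<alpha> n \<pi> x"
  by (rule linear_on_Q_uminus_arg[OF cyc_linear[OF assms(2,3)] assms(1)])

text \<open>
  Every permutation is a rotation followed by an element of \<open>\<SS>\<^sub>n\<close>, and \<open>S\<close> is stable under \<open>\<SS>\<^sub>n\<close>.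
\<close>

lemma cyc_mem_if_long_cycle_mem:
  assumes S: "suboperad P S" and n: "1 \<le> n" and x: "x \<in> components P n"
    and rot: "\<And>k. \<alpha> n (long_cycle n ^^ k) x \<in> S n" and \<pi>: "\<pi> permutes {1..n + 1}"
  shows "\<alpha> n \<pi> x \<in> S n"
proof -
  obtain s k where s: "s permutes {1..n}" "\<pi> = s \<circ> long_cycle n ^^ k"
    using permutes_decomposition[OF \<pi>] by metis
  have s': "s permutes {1..n + 1}" using s(1) by (rule permutes_subset) auto
  have "\<alpha> n \<pi> x = perm_act P n s (\<alpha> n (long_cycle n ^^ k) x)"
    using cyc_comp[OF x n s' long_cycle_funpow_permutes] cyc_extends[OF _ n s(1)]
      cyc_closed[OF x n long_cycle_funpow_permutes] s(2) by simp
  then show ?thesis using S n s(1) rot by (simp add: suboperad_def)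
qed

text \<open>
  The largest subfamily of \<open>S\<close> that is stable under the extended actions.
\<close>

definition stable_part :: "(nat \<Rightarrow> 'a set) \<Rightarrow> nat \<Rightarrow> 'a set" where
  "stable_part S n = {x \<in> S n. \<forall>\<pi>. \<pi> permutes {1..n + 1} \<longrightarrow> \<alpha> n \<pi> x \<in> S n}"

text \<open>
  A rotation of a composite \<open>f \<circ>\<^sub>i g\<close> is, up to sign, a composite of rotations of \<open>f\<close> and \<open>g\<close>, possibly in
  the other order. Iterating this inside the stable part shows that all rotations of \<open>f \<circ>\<^sub>i g\<close> stay in \<open>S\<close>.
\<close>

lemma suboperad_stable_part:
  assumes S: "suboperad P S"
  shows "suboperad P (stable_part S)"
proof -
  have sub: "rat_vector.subspace (S n)" "S n \<subseteq> components P n" if "1 \<le> n" for n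
    using S that by (simp_all add: suboperad_def)
  have mem: "x \<in> components P n" if "x \<in> S n" "1 \<le> n" for x n using sub that by blast
  have subspace_stable: "rat_vector.subspace (stable_part S n)" if n: "1 \<le> n" for n
    unfolding rat_vector.subspace_def
  proof (intro conjI ballI allI)
    have "\<alpha> n \<pi> 0 = 0" if "\<pi> permutes {1..n + 1}" for \<pi>
      using linear_on_Q_0[OF cyc_linear[OF n that]] rat_vector.subspace_0[OF subspace[OF n]] .
    then show "0 \<in> stable_part S n"
      using rat_vector.subspace_0[OF sub(1)[OF n]] by (simp add: stable_part_def)
    show "x + y \<in> stable_part S n" if "x \<in> stable_part S n" "y \<in> stable_part S n" for x y
      using that cyc_linear[OF n] rat_vector.subspace_add[OF sub(1)[OF n]] mem[OF _ n]
      by (simp add: stable_part_def linear_on_Q_def)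
    show "c *\<^sub>Q x \<in> stable_part S n" if "x \<in> stable_part S n" for x c
      using that cyc_linear[OF n] rat_vector.subspace_scale[OF sub(1)[OF n]] mem[OF _ n]
      by (simp add: stable_part_def linear_on_Q_def)
  qed
  have stable_cyc: "\<alpha> n \<rho> x \<in> stable_part S n"
    if x: "x \<in> stable_part S n" and n: "1 \<le> n" and \<rho>: "\<rho> permutes {1..n + 1}" for x n \<rho>
    using x n \<rho> cyc_comp[OF mem n _ \<rho>, of x] permutes_compose[OF \<rho>]
    by (auto simp: stable_part_def) metis
  have rot_Suc: "\<alpha> n (long_cycle n ^^ Suc k) x = \<alpha> n (long_cycle n ^^ k) (\<alpha> n (long_cycle n) x)"
    if "x \<in> components P n" "1 \<le> n" for n k x
    using cyc_comp[OF that long_cycle_funpow_permutes long_cycle_permutes]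
    by (simp add: funpow_Suc_right del: funpow.simps)
  have id: "\<alpha> n id x = x" if "x \<in> components P n" "1 \<le> n" for n x
    using cyc_action[OF that(2)] that(1) by (simp add: linear_sym_action_def)
  have unit_S: "op_unit P \<in> S 1" using S by (simp add: suboperad_def)
  have rot_unit: "\<alpha> 1 (long_cycle 1 ^^ k) (op_unit P) \<in> S 1" for k
  proof (induction k)
    case 0
    then show ?case using id[OF unit_closed order_refl] unit_S by (simp only: funpow.simps)
  next
    case (Suc k)
    have "\<alpha> 1 (long_cycle 1 ^^ Suc k) (op_unit P) = - \<alpha> 1 (long_cycle 1 ^^ k) (op_unit P)"
      unfolding rot_Suc[OF unit_closed order_refl] cyc_unit
      by (rule cyc_uminus[OF unit_closed order_refl long_cycle_funpow_permutes])
    then show ?case using Suc rat_vector.subspace_neg[OF sub(1)[OF order_refl]] by (simp only:)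
  qed
  have rot_pcomp: "\<alpha> (m + n - 1) (long_cycle (m + n - 1) ^^ k) (pcomp P m n i f g) \<in> S (m + n - 1)"
    if "f \<in> stable_part S m" "g \<in> stable_part S n" "1 \<le> i" "i \<le> m" "1 \<le> n" for m n i f g k
    using that
  proof (induction k arbitrary: m n i f g)
    case 0
    then have S': "pcomp P m n i f g \<in> S (m + n - 1)"
      using S by (simp add: suboperad_def stable_part_def)
    then show ?case using 0 id[OF mem[OF S']] by (simp only: funpow.simps)
  next
    case (Suc k)
    have bounds: "1 \<le> m" "1 \<le> m + n - 1" using Suc.prems by auto
    have fg: "f \<in> components P m" "g \<in> components P n"
      using Suc.prems mem bounds by (auto simp: stable_part_def)
    have fg': "\<alpha> m (long_cycle m) f \<in> stable_part S m" "\<alpha> n (long_cycle n) g \<in> stable_part S n"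
      using Suc.prems bounds by (auto intro!: stable_cyc long_cycle_permutes simp del: One_nat_def)
    have eq: "\<alpha> (m + n - 1) (long_cycle (m + n - 1) ^^ Suc k) (pcomp P m n i f g)
        = \<alpha> (m + n - 1) (long_cycle (m + n - 1) ^^ k)
            (\<alpha> (m + n - 1) (long_cycle (m + n - 1)) (pcomp P m n i f g))"
      using pcomp_closed[OF fg Suc.prems(3-5)] bounds by (intro rot_Suc)
    show ?case
    proof (cases "i = 1")
      case False
      then have "2 \<le> i" "1 \<le> i - 1" "i - 1 \<le> m" using Suc.prems by auto
      then show ?thesis
        unfolding eq cyc_pcomp[OF fg \<open>2 \<le> i\<close> Suc.prems(4,5)]
        using Suc.IH[OF fg'(1) Suc.prems(2)] Suc.prems(5) by simp
    next
      case True
      let ?h = "pcomp P n m n (\<alpha> n (long_cycle n) g) (\<alpha> m (long_cycle m) f)"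
      have comm: "n + m - 1 = m + n - 1" by simp
      have h: "?h \<in> components P (m + n - 1)"
        using pcomp_closed[OF cyc_closed[OF fg(2) Suc.prems(5) long_cycle_permutes]
            cyc_closed[OF fg(1) bounds(1) long_cycle_permutes] Suc.prems(5) order_refl bounds(1)]
        unfolding comm .
      have "\<alpha> (m + n - 1) (long_cycle (m + n - 1) ^^ k) ?h \<in> S (m + n - 1)"
        using Suc.IH[OF fg'(2,1) Suc.prems(5) order_refl bounds(1)] unfolding comm .
      then have "\<alpha> (m + n - 1) (long_cycle (m + n - 1) ^^ k) (- ?h) \<in> S (m + n - 1)"
        unfolding cyc_uminus[OF h bounds(2) long_cycle_funpow_permutes]
        by (rule rat_vector.subspace_neg[OF sub(1)[OF bounds(2)]])
      then show ?thesis
        unfolding True eq[unfolded True] cyc_pcomp_first[OF fg bounds(1) Suc.prems(5)] .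
    qed
  qed
  show ?thesis
    unfolding suboperad_def
  proof (intro conjI allI impI ballI)
    show "rat_vector.subspace (stable_part S n)" "stable_part S n \<subseteq> components P n" if "1 \<le> n" for n
      using subspace_stable[OF that] sub(2)[OF that] by (auto simp: stable_part_def)
    show "op_unit P \<in> stable_part S 1"
      using unit_S cyc_mem_if_long_cycle_mem[OF S order_refl unit_closed rot_unit]
      by (simp add: stable_part_def)
    show "pcomp P m n i f g \<in> stable_part S (m + n - 1)"
      if "1 \<le> i" "i \<le> m" "1 \<le> n" "f \<in> stable_part S m" "g \<in> stable_part S n" for m n i f g
    proof -
      have S': "pcomp P m n i f g \<in> S (m + n - 1)" and N: "1 \<le> m + n - 1"
        using S that by (auto simp: suboperad_def stable_part_def)
      then show ?thesis
        using cyc_mem_if_long_cycle_mem[OF S N mem[OF S' N] rot_pcomp[OF that(4,5,1-3)]]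
        by (simp add: stable_part_def)
    qed
    show "perm_act P n \<sigma> x \<in> stable_part S n"
      if "1 \<le> n" "\<sigma> permutes {1..n}" "x \<in> stable_part S n" for n \<sigma> x
    proof -
      have "\<sigma> permutes {1..n + 1}" using that(2) by (rule permutes_subset) auto
      moreover have "x \<in> components P n" using that mem by (simp add: stable_part_def)
      ultimately show ?thesis using stable_cyc[OF that(3,1)] cyc_extends[OF _ that(1,2)] by metis
    qed
  qed
qed

end

text \<open>
  The stable part is a suboperad containing the generators, hence it contains everything they generate.
\<close>

lemma generated_suboperad_cyc_stable:
  assumes "anticyclic_operad P \<alpha>" and X: "\<And>k. 1 \<le> k \<Longrightarrow> X k \<subseteq> components P k"
    and rot: "\<And>n x k. \<lbrakk>1 \<le> n; x \<in> X n\<rbrakk>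
      \<Longrightarrow> \<alpha> n (long_cycle n ^^ k) x \<in> components (generated_suboperad P X) n"
    and "1 \<le> n" "\<pi> permutes {1..n + 1}" and x: "x \<in> components (generated_suboperad P X) n"
  shows "\<alpha> n \<pi> x \<in> components (generated_suboperad P X) n"
proof -
  interpret anticyclic_operad P \<alpha> by fact
  let ?G = "components (generated_suboperad P X)"
  have G: "suboperad P ?G" by (rule suboperad_generated[OF operad_axioms X])
  have "X k \<subseteq> stable_part ?G k" if k: "1 \<le> k" for k
    using generators_subset[OF k, of X P] cyc_mem_if_long_cycle_mem[OF G k _ rot[OF k]] X[OF k]
    by (auto simp: stable_part_def)
  then have "x \<in> stable_part ?G n"
    using x suboperad_stable_part[OF G] by (simp only: generated_suboperad_mem) blast
  then show ?thesis using assms(5) by (simp add: stable_part_def)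
qed

section \<open>The pre-Lie operad\<close>

lemma Dend_generators: "dend_prec \<in> components Dend 2" "dend_succ \<in> components Dend 2"
  by (auto simp: Dend_def dend_prec_def dend_succ_def intro!: imageI)

lemma long_cycle_transpose: "long_cycle 2 \<circ> transpose 1 2 = transpose 1 2 \<circ> long_cycle 2 ^^ 2"
  by (auto simp: fun_eq_iff long_cycle_def transpose_def numeral_2_eq_2)

context
  fixes \<tau> :: "nat \<Rightarrow> dend \<Rightarrow> dend"
  assumes dend: "ns_anticyclic_operad Dend \<tau>"
    and tau_succ: "\<tau> 2 dend_succ = dend_prec"
    and tau_prec: "\<tau> 2 dend_prec = - dend_prec - dend_succ"
begin

interpretation symmetrized_anticyclic_operad Dend \<tau>
  by (intro symmetrized_anticyclic_operad.intro symmetrized_operad.intro dend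
      ns_anticyclic_operad.axioms(1)[OF dend])

interpretation sym: anticyclic_operad Dend_sym "induced_action \<tau>"
  unfolding Dend_sym_def by (rule sym_anticyclic_operad)

lemma transpose_permutes: "transpose 1 (2::nat) permutes {1..2}"
  by (rule permutes_swap_id) auto

lemma prelie_product_eq: "prelie_product = tens dend_succ (transpose 1 2) - tens dend_prec id"
  using sym_perm_act_tens[OF permutes_id, of 2 "transpose 1 2" dend_succ]
  by (simp add: prelie_product_def Dend_sym_def)

text \<open>
  The product \<open>x\<^sub>2 \<curvearrowleft> x\<^sub>1 = x\<^sub>1 \<succ> x\<^sub>2 - x\<^sub>2 \<prec> x\<^sub>1\<close>.
\<close>

definition opposite_product :: "(nat \<Rightarrow> nat) \<Rightarrow> dend" where
  "opposite_product = tens dend_succ id - tens dend_prec (transpose 1 2)"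

lemma products_closed:
  "prelie_product \<in> components Dend_sym 2" "opposite_product \<in> components Dend_sym 2"
  unfolding prelie_product_eq opposite_product_def Dend_sym_def
  by (intro rat_vector.subspace_diff[OF sym_subspace] tens_closed Dend_generators transpose_permutes
      permutes_id; simp)+

text \<open>
  As \<open>c \<circ> (1 2) = (1 2) \<circ> c\<^sup>2\<close>, the long cycle acts by \<open>\<tau>\<close> on the terms carrying the identity and by \<open>\<tau>\<^sup>2\<close> on those
  carrying the transposition, where \<open>\<tau>\<^sup>2\<close> maps \<open>\<succ>\<close> to \<open>- \<prec> - \<succ>\<close> and \<open>\<prec>\<close> to \<open>\<succ>\<close>.
\<close>

lemma act_long_cycle_products:
  "induced_action \<tau> 2 (long_cycle 2) prelie_product = opposite_product - prelie_product"
  "induced_action \<tau> 2 (long_cycle 2) opposite_product = - prelie_product"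
proof -
  let ?s = "transpose 1 (2::nat)" and ?a = "induced_action \<tau> 2 (long_cycle 2)"
  have lin: "linear_on_Q (components SymP 2) ?a" by (rule act_linear) simp
  note diff = linear_on_Q_diff[OF lin sym_subspace]
  have "\<tau> 2 (- dend_prec - dend_succ) = \<tau> 2 (- dend_prec) - \<tau> 2 dend_succ"
    using rat_vector.subspace_neg[OF subspace Dend_generators(1)] Dend_generators(2)
    by (intro linear_on_Q_diff[OF tau_linear subspace]) simp_all
  also have "\<tau> 2 (- dend_prec) = - \<tau> 2 dend_prec"
    using tau_funpow_uminus[OF Dend_generators(1), of 1] by simp
  finally have tau_prec2: "\<tau> 2 (\<tau> 2 dend_prec) = dend_succ"
    by (simp add: tau_prec tau_succ)
  have id: "?a (tens E id) = tens (\<tau> 2 E) id" if "E \<in> components Dend 2" for E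
    using act_tens[OF that _ permutes_id permutes_id, of "long_cycle 2" 1] by simp
  have s: "?a (tens E ?s) = tens (\<tau> 2 (\<tau> 2 E)) ?s" if "E \<in> components Dend 2" for E
    using act_tens[OF that _ transpose_permutes transpose_permutes long_cycle_transpose]
    by (simp add: numeral_2_eq_2)
  note closed = tens_closed[OF Dend_generators(1)] tens_closed[OF Dend_generators(2)]
  have tens_diff: "tens (E - F) \<pi> = tens E \<pi> - tens F \<pi>" for E F :: dend and \<pi>
    using tens_add[of E "- F" \<pi>] by (simp add: tens_uminus)
  show "?a prelie_product = opposite_product - prelie_product"
    unfolding prelie_product_eq opposite_product_def
    using closed transpose_permutes permutes_id
    by (simp add: diff id s Dend_generators tau_succ tau_prec tens_diff tens_uminus del: One_nat_def)
  show "?a opposite_product = - prelie_product"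
    unfolding prelie_product_eq opposite_product_def
    using closed transpose_permutes permutes_id
    by (simp add: diff id s Dend_generators tau_succ tau_prec2 tens_diff tens_uminus del: One_nat_def)
qed

lemma act_long_cycle_power_prelie_product:
  "\<exists>a b. induced_action \<tau> 2 (long_cycle 2 ^^ k) prelie_product
     = a *\<^sub>Q prelie_product + b *\<^sub>Q opposite_product"
proof (induction k)
  case 0
  have "induced_action \<tau> 2 id prelie_product = prelie_product"
    using sym.cyc_action[of 2] products_closed by (simp add: linear_sym_action_def)
  then have "induced_action \<tau> 2 (long_cycle 2 ^^ 0) prelie_product
      = 1 *\<^sub>Q prelie_product + 0 *\<^sub>Q opposite_product"
    by (simp only: funpow.simps) simp
  then show ?case by blast
next
  case (Suc k)
  then obtain a b where ab: "induced_action \<tau> 2 (long_cycle 2 ^^ k) prelie_product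
      = a *\<^sub>Q prelie_product + b *\<^sub>Q opposite_product" by blast
  have "induced_action \<tau> 2 (long_cycle 2 ^^ Suc k) prelie_product
      = induced_action \<tau> 2 (long_cycle 2) (a *\<^sub>Q prelie_product + b *\<^sub>Q opposite_product)"
    using sym.cyc_comp[OF products_closed(1) _ long_cycle_permutes long_cycle_funpow_permutes]
    by (simp add: ab)
  also have "\<dots> = a *\<^sub>Q (opposite_product - prelie_product) + b *\<^sub>Q (- prelie_product)"
    using act_linear[of 2 "long_cycle 2"] products_closed act_long_cycle_products
      rat_vector.subspace_scale[OF sym.subspace[of 2]]
    by (simp add: linear_on_Q_def Dend_sym_def)
  also have "\<dots> = (- a - b) *\<^sub>Q prelie_product + a *\<^sub>Q opposite_product"
    by (simp add: rat_vector.scale_right_diff_distrib rat_vector.scale_left_diff_distrib)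
  finally show ?case by blast
qed

lemma prelie_product_closed:
  "1 \<le> k \<Longrightarrow> (if k = 2 then {prelie_product} else {}) \<subseteq> components Dend_sym k"
  using products_closed by simp

lemma suboperad_PreLie: "suboperad Dend_sym (components PreLie)"
  unfolding PreLie_def by (rule suboperad_generated[OF sym.operad_axioms prelie_product_closed])

lemma products_PreLie: "prelie_product \<in> components PreLie 2" "opposite_product \<in> components PreLie 2"
proof -
  show p: "prelie_product \<in> components PreLie 2"
    using generators_subset[of 2 "\<lambda>n. if n = 2 then {prelie_product} else {}" Dend_sym]
    by (simp add: PreLie_def)
  have "perm_act Dend_sym 2 (transpose 1 2) prelie_product
      = perm_act SymP 2 (transpose 1 2) (tens dend_succ (transpose 1 2))
        - perm_act SymP 2 (transpose 1 2) (tens dend_prec id)"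
    unfolding prelie_product_eq Dend_sym_def
    by (intro linear_on_Q_diff[OF sym_perm_act_linear sym_subspace] tens_closed Dend_generators
        transpose_permutes permutes_id) simp_all
  also have "\<dots> = opposite_product"
    unfolding sym_perm_act_tens[OF transpose_permutes] sym_perm_act_tens[OF permutes_id]
    by (simp add: opposite_product_def)
  finally have "perm_act Dend_sym 2 (transpose 1 2) prelie_product = opposite_product" .
  then show "opposite_product \<in> components PreLie 2"
    using suboperad_perm_act[OF suboperad_PreLie _ transpose_permutes p] by simp
qed

lemma PreLie_cyc_stable:
  assumes "1 \<le> n" "\<pi> permutes {1..n + 1}" "x \<in> components PreLie n"
  shows "induced_action \<tau> n \<pi> x \<in> components PreLie n"
  unfolding PreLie_def
proof (rule generated_suboperad_cyc_stable[OF sym.anticyclic_operad_axioms prelie_product_closed])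
  fix n :: nat and x k assume "1 \<le> n" "x \<in> (if n = 2 then {prelie_product} else {})"
  then have [simp]: "n = 2" "x = prelie_product" by (auto split: if_splits)
  obtain a b where "induced_action \<tau> 2 (long_cycle 2 ^^ k) prelie_product
      = a *\<^sub>Q prelie_product + b *\<^sub>Q opposite_product"
    using act_long_cycle_power_prelie_product by blast
  then have "induced_action \<tau> 2 (long_cycle 2 ^^ k) prelie_product \<in> components PreLie 2"
    using suboperad_PreLie products_PreLie
    by (simp add: suboperad_def rat_vector.subspace_add rat_vector.subspace_scale)
  then show "induced_action \<tau> n (long_cycle n ^^ k) x
      \<in> components (generated_suboperad Dend_sym (\<lambda>n. if n = 2 then {prelie_product} else {})) n"
    by (simp add: PreLie_def)
qed (use assms in \<open>simp_all add: PreLie_def\<close>)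

lemma PreLie_eq: "PreLie = Dend_sym\<lparr>components := components PreLie\<rparr>"
  by (simp add: PreLie_def generated_suboperad_def)

lemmas PreLie_anticyclic = suboperad_anticyclic[OF sym.anticyclic_operad_axioms suboperad_PreLie
    PreLie_cyc_stable, folded PreLie_eq]

end

theorem theorem5p6:
  fixes \<tau> :: "nat \<Rightarrow> dend \<Rightarrow> dend"
  assumes "ns_anticyclic_operad Dend \<tau>"
    and "\<forall>x\<in>components Dend 1. \<tau> 1 x = - x"
    and "\<tau> 2 dend_succ = dend_prec"
    and "\<tau> 2 dend_prec = - dend_prec - dend_succ"
  shows "\<exists>\<alpha>.
    anticyclic_operad PreLie \<alpha> \<and>
    anticyclic_morphism PreLie \<alpha> Dend_sym (induced_action \<tau>) (\<lambda>n x. x) \<and>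
    (\<forall>\<alpha>'. anticyclic_operad PreLie \<alpha>' \<and>
          anticyclic_morphism PreLie \<alpha>' Dend_sym (induced_action \<tau>) (\<lambda>n x. x) \<longrightarrow>
          (\<forall>n\<ge>1. \<forall>\<sigma>. \<sigma> permutes {1..n + 1} \<longrightarrow>
             (\<forall>x\<in>components PreLie n. \<alpha>' n \<sigma> x = \<alpha> n \<sigma> x)))"
proof (intro exI conjI allI impI ballI)
  show "anticyclic_operad PreLie (induced_action \<tau>)"
    and "anticyclic_morphism PreLie (induced_action \<tau>) Dend_sym (induced_action \<tau>) (\<lambda>n x. x)"
    using PreLie_anticyclic[OF assms(1,3,4)] by simp_all
  fix \<alpha>' n \<sigma> x
  assume \<alpha>': "anticyclic_operad PreLie \<alpha>' \<and>
      anticyclic_morphism PreLie \<alpha>' Dend_sym (induced_action \<tau>) (\<lambda>n x. x)"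
    and "1 \<le> n" "\<sigma> permutes {1..n + 1}" "x \<in> components PreLie n"
  then show "\<alpha>' n \<sigma> x = induced_action \<tau> n \<sigma> x"
    by (intro anticyclic_morphism.map_cyc[OF conjunct2[OF \<alpha>']])
qed

end
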